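(* Let $\Sigma$ be a signed alphabet. Consider the rewriting system $\mathrm{Col}_2(\Sigma)$ on the free monoid generated by the symbols $c_u$, where $u$ ranges over nonempty super columns over $\Sigma$. Its rules are $$\gamma_{u,v}:\ c_uc_v\Rightarrow c_wc_{w'},$$ one for each pair of nonempty super columns $u,v$ such that the topmost juxtaposition of $[u]_r$ and $[v]_r$ does not form a super tableau. Here: - if $[uv]_r$ has two columns, $w$ and $w'$ are the readings of its left and right columns respectively; - if $[uv]_r$ has one column, $w=uv$ and $c_{w'}$ is the empty word. Then $\mathrm{Col}_2(\Sigma)$ is convergent (terminating and confluent), and the monoid it presents is isomorphic to the super plactic monoid $\mathbf{P}(\Sigma)$.
   Context: A signed alphabet is a finite or countable totally ordered set $\Sigma$ with a map $\|\cdot\|:\Sigma\to\mathbb{Z}_2$; write $\Sigma_0=\|\cdot\|^{-1}(0)$ and $\Sigma_1=\|\cdot\|^{-1}(1)$. A super column is a word $x_1\ldots x_k$ over $\Sigma$ with $x_{i+1}\le x_i$, where $x_i=x_{i+1}$ only if $\|x_i\|=1$. A super tableau is a filling $T$ of a Young diagram by elements of $\Sigma$ such that: - $T(i,j)\le T(i,j+1)$, with equality only if $\|T(i,j)\|=0$; - $T(i,j)\le T(i+1,j)$, with equality only if $\|T(i,j)\|=1$. The reading of a column lists its entries from bottom to top. Right insertion $t\leftarrow x$ works as follows. - If $x\in\Sigma_0$ (resp. $\Sigma_1$) is $\ge$ (resp. $>$) the last entry of the top row, append it to that row. - Otherwise, $x$ replaces the smallest entry $y$ of the top row with $y>x$ (resp.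 $y\ge x$), and $y$ is inserted in the same way into the next row (a new row if none). $[w]_r$ denotes the result of inserting the letters of $w$ from left to right into the empty tableau. For super columns $u=x_1\ldots x_p$ and $v=y_1\ldots y_q$, the topmost juxtaposition of $[u]_r$ and $[v]_r$ forms a super tableau iff $p\ge q$ and $x_i\le y_i$ for all $i\le q$, with $x_i=y_i$ only if $\|x_i\|=0$. $\mathbf{P}(\Sigma)$ is the quotient of $\Sigma^*$ by the congruence generated by the following relations: - $zxy=xzy$ for $x\le y\le z$, with $x=y$ only if $\|y\|=0$ and $y=z$ only if $\|y\|=1$; - $yzx=yxz$ for $x\le y\le z$, with $x=y$ only if $\|y\|=1$ and $y=z$ only if $\|y\|=0$. *)

theory Defs
  imports "HOL-Algebra.Group" "HOL-Library.Z2" "HOL-Library.Confluence" "HOL-Library.Countable_Set"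
begin

text \<open>
  A signed alphabet is a countable set \<open>S\<close> of elements of a linearly ordered type, together with
  a map \<open>p\<close> to \<^typ>\<open>bit\<close> (the two-element field); the values of \<open>p\<close> outside \<open>S\<close> are irrelevant.
\<close>

section \<open>Super columns and super tableaux\<close>

definition super_column :: "('a::linorder \<Rightarrow> bit) \<Rightarrow> 'a list \<Rightarrow> bool" where
  "super_column p u \<longleftrightarrow> successively (\<lambda>x y. y \<le> x \<and> (x = y \<longrightarrow> p x = 1)) u"

definition super_columns :: "'a::linorder set \<Rightarrow> ('a \<Rightarrow> bit) \<Rightarrow> 'a list set" where
  "super_columns S p = {u \<in> lists S. super_column p u}"

text \<open>
  A filling is the list of its rows, from top to bottom, so that the entry \<open>T(i,j)\<close> is
  \<open>T ! i ! j\<close> (counting from 0). The first two conditions say that the shape is a Young diagram.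
\<close>

definition super_tableau :: "'a::linorder set \<Rightarrow> ('a \<Rightarrow> bit) \<Rightarrow> 'a list list \<Rightarrow> bool" where
  "super_tableau S p T \<longleftrightarrow>
     [] \<notin> set T \<and>
     (\<forall>i. Suc i < length T \<longrightarrow> length (T ! Suc i) \<le> length (T ! i)) \<and>
     (\<forall>r \<in> set T. r \<in> lists S) \<and>
     (\<forall>i j. i < length T \<and> Suc j < length (T ! i) \<longrightarrow>
        T ! i ! j \<le> T ! i ! Suc j \<and> (T ! i ! j = T ! i ! Suc j \<longrightarrow> p (T ! i ! j) = 0)) \<and>
     (\<forall>i j. Suc i < length T \<and> j < length (T ! Suc i) \<longrightarrow>
        T ! i ! j \<le> T ! Suc i ! j \<and> (T ! i ! j = T ! Suc i ! j \<longrightarrow> p (T ! i ! j) = 1))"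

text \<open>\<^const>\<open>transpose\<close> lists the columns of \<open>T\<close> from left to right, each one from top to bottom.\<close>

definition column_readings :: "'a list list \<Rightarrow> 'a list list" where
  "column_readings T = map rev (transpose T)"

text \<open>
  The topmost juxtaposition of \<open>T\<close> and \<open>T'\<close> has the columns of \<open>T\<close> followed by those of \<open>T'\<close>, with
  the tops aligned. It is expressed through columns because concatenating rows would lose the
  horizontal position of the entries of \<open>T'\<close> lying below the last row of \<open>T\<close>; if there are such
  entries, then no \<open>R\<close> below exists.
\<close>

definition juxtaposition_tableau ::
    "'a::linorder set \<Rightarrow> ('a \<Rightarrow> bit) \<Rightarrow> 'a list list \<Rightarrow> 'a list list \<Rightarrow> bool" where
  "juxtaposition_tableau S p T T' \<longleftrightarrow>
     (\<exists>R. super_tableau S p R \<and> transpose R = transpose T @ transpose T')"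

section \<open>Right insertion\<close>

definition bumps :: "('a::linorder \<Rightarrow> bit) \<Rightarrow> 'a \<Rightarrow> 'a \<Rightarrow> bool" where
  "bumps p x y \<longleftrightarrow> (if p x = 0 then y > x else y \<ge> x)"

text \<open>
  Rows of a super tableau are weakly increasing. Hence \<open>x\<close> is appended to the row \<open>r\<close> iff it bumps
  no entry of \<open>r\<close>, and the smallest entry bumped by \<open>x\<close> is the leftmost one bumped by \<open>x\<close>.
\<close>

fun right_insert :: "('a::linorder \<Rightarrow> bit) \<Rightarrow> 'a list list \<Rightarrow> 'a \<Rightarrow> 'a list list" where
  "right_insert p [] x = [[x]]"
| "right_insert p (r # rs) x =
     (case dropWhile (\<lambda>y. \<not> bumps p x y) r of
        [] \<Rightarrow> (r @ [x]) # rs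
      | y # ys \<Rightarrow> (takeWhile (\<lambda>y. \<not> bumps p x y) r @ x # ys) # right_insert p rs y)"

definition insertion_tableau :: "('a::linorder \<Rightarrow> bit) \<Rightarrow> 'a list \<Rightarrow> 'a list list" where
  "insertion_tableau p w = foldl (right_insert p) [] w"

section \<open>Rewriting systems and presented monoids\<close>

text \<open>
  Words over the generating set \<open>A\<close> are the elements of \<^term>\<open>lists A\<close>, and a rewriting system is a
  set of pairs (source, target) of words.
\<close>

inductive rewrite_step :: "'g set \<Rightarrow> ('g list \<times> 'g list) set \<Rightarrow> 'g list \<Rightarrow> 'g list \<Rightarrow> bool"
  for A R where
  "\<lbrakk>(l, r) \<in> R; l \<in> lists A; r \<in> lists A; a \<in> lists A; b \<in> lists A\<rbrakk>
     \<Longrightarrow> rewrite_step A R (a @ l @ b) (a @ r @ b)"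

definition terminating_rs :: "'g set \<Rightarrow> ('g list \<times> 'g list) set \<Rightarrow> bool" where
  "terminating_rs A R \<longleftrightarrow> wfp (rewrite_step A R)\<inverse>\<inverse>"

definition confluent_rs :: "'g set \<Rightarrow> ('g list \<times> 'g list) set \<Rightarrow> bool" where
  "confluent_rs A R \<longleftrightarrow> confluentp (rewrite_step A R)"

definition convergent_rs :: "'g set \<Rightarrow> ('g list \<times> 'g list) set \<Rightarrow> bool" where
  "convergent_rs A R \<longleftrightarrow> terminating_rs A R \<and> confluent_rs A R"

inductive gen_cong :: "'g set \<Rightarrow> ('g list \<times> 'g list) set \<Rightarrow> 'g list \<Rightarrow> 'g list \<Rightarrow> bool"
  for A R where
  base: "\<lbrakk>(u, v) \<in> R; u \<in> lists A; v \<in> lists A\<rbrakk> \<Longrightarrow> gen_cong A R u v"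
| refl: "u \<in> lists A \<Longrightarrow> gen_cong A R u u"
| sym: "gen_cong A R u v \<Longrightarrow> gen_cong A R v u"
| trans: "\<lbrakk>gen_cong A R u v; gen_cong A R v w\<rbrakk> \<Longrightarrow> gen_cong A R u w"
| append: "\<lbrakk>gen_cong A R u v; gen_cong A R u' v'\<rbrakk> \<Longrightarrow> gen_cong A R (u @ u') (v @ v')"

definition cong_class :: "'g set \<Rightarrow> ('g list \<times> 'g list) set \<Rightarrow> 'g list \<Rightarrow> 'g list set" where
  "cong_class A R u = {v. gen_cong A R u v}"

text \<open>The union in the product is over a family all of whose members are equal.\<close>

definition presented_monoid :: "'g set \<Rightarrow> ('g list \<times> 'g list) set \<Rightarrow> 'g list set monoid" where
  "presented_monoid A R =
     \<lparr>carrier = cong_class A R ` lists A,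
      mult = (\<lambda>X Y. \<Union>x\<in>X. \<Union>y\<in>Y. cong_class A R (x @ y)),
      one = cong_class A R []\<rparr>"

lemma gen_cong_in_lists: "gen_cong A R u v \<Longrightarrow> u \<in> lists A \<and> v \<in> lists A"
  by (induction rule: gen_cong.induct) auto

lemma cong_class_eq_iff:
  assumes "u \<in> lists A"
  shows "cong_class A R u = cong_class A R v \<longleftrightarrow> gen_cong A R u v"
proof
  assume "cong_class A R u = cong_class A R v"
  moreover have "u \<in> cong_class A R u"
    using assms by (simp add: cong_class_def gen_cong.refl)
  ultimately have "gen_cong A R v u" by (simp add: cong_class_def)
  then show "gen_cong A R u v" by (rule gen_cong.sym)
next
  assume "gen_cong A R u v"
  then show "cong_class A R u = cong_class A R v"
    unfolding cong_class_def by (blast intro: gen_cong.sym gen_cong.trans)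
qed

lemma presented_monoid_mult_class:
  assumes "u \<in> lists A" "v \<in> lists A"
  shows "cong_class A R u \<otimes>\<^bsub>presented_monoid A R\<^esub> cong_class A R v = cong_class A R (u @ v)"
proof -
  have uv: "u @ v \<in> lists A" using assms by simp
  have "cong_class A R (x @ y) = cong_class A R (u @ v)"
    if "x \<in> cong_class A R u" "y \<in> cong_class A R v" for x y
  proof -
    have "gen_cong A R (u @ v) (x @ y)"
      using that by (simp add: cong_class_def gen_cong.append)
    then show ?thesis using cong_class_eq_iff[OF uv] by blast
  qed
  moreover have "u \<in> cong_class A R u" "v \<in> cong_class A R v"
    using assms by (simp_all add: cong_class_def gen_cong.refl)
  ultimately have "(\<Union>x\<in>cong_class A R u. \<Union>y\<in>cong_class A R v. cong_class A R (x @ y)) =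
      cong_class A R (u @ v)"
    by blast
  then show ?thesis by (simp add: presented_monoid_def)
qed

lemma monoid_presented_monoid: "monoid (presented_monoid A R)" (is "monoid ?M")
proof
  have c: "x \<in> carrier ?M \<longleftrightarrow> (\<exists>u. u \<in> lists A \<and> x = cong_class A R u)" for x
    by (auto simp: presented_monoid_def)
  have o: "\<one>\<^bsub>?M\<^esub> = cong_class A R []"
    by (simp add: presented_monoid_def)
  note m = presented_monoid_mult_class
  show "x \<otimes>\<^bsub>?M\<^esub> y \<in> carrier ?M" if "x \<in> carrier ?M" "y \<in> carrier ?M" for x y
    using that unfolding c by (metis m append_in_lists_conv)
  show "x \<otimes>\<^bsub>?M\<^esub> y \<otimes>\<^bsub>?M\<^esub> z = x \<otimes>\<^bsub>?M\<^esub> (y \<otimes>\<^bsub>?M\<^esub> z)"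
    if "x \<in> carrier ?M" "y \<in> carrier ?M" "z \<in> carrier ?M" for x y z
    using that unfolding c by (metis m append_in_lists_conv append_assoc)
  show "\<one>\<^bsub>?M\<^esub> \<in> carrier ?M"
    unfolding c o by (metis lists.Nil)
  show "\<one>\<^bsub>?M\<^esub> \<otimes>\<^bsub>?M\<^esub> x = x" if "x \<in> carrier ?M" for x
    using that unfolding c o by (metis m lists.Nil append_Nil)
  show "x \<otimes>\<^bsub>?M\<^esub> \<one>\<^bsub>?M\<^esub> = x" if "x \<in> carrier ?M" for x
    using that unfolding c o by (metis m lists.Nil append_Nil2)
qed

section \<open>The super plactic monoid and its column presentation\<close>

definition super_plactic_relations ::
    "'a::linorder set \<Rightarrow> ('a \<Rightarrow> bit) \<Rightarrow> ('a list \<times> 'a list) set" where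
  "super_plactic_relations S p =
     {([z, x, y], [x, z, y]) | x y z. x \<in> S \<and> y \<in> S \<and> z \<in> S \<and> x \<le> y \<and> y \<le> z \<and>
        (x = y \<longrightarrow> p y = 0) \<and> (y = z \<longrightarrow> p y = 1)} \<union>
     {([y, z, x], [y, x, z]) | x y z. x \<in> S \<and> y \<in> S \<and> z \<in> S \<and> x \<le> y \<and> y \<le> z \<and>
        (x = y \<longrightarrow> p y = 1) \<and> (y = z \<longrightarrow> p y = 0)}"

definition super_plactic_monoid ::
    "'a::linorder set \<Rightarrow> ('a \<Rightarrow> bit) \<Rightarrow> 'a list set monoid" where
  "super_plactic_monoid S p = presented_monoid S (super_plactic_relations S p)"

text \<open>
  The symbol \<open>c\<^sub>u\<close> is represented by the nonempty super column \<open>u\<close> itself, so that a word in these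
  symbols is a list of super columns.
\<close>

definition Col :: "'a::linorder set \<Rightarrow> ('a \<Rightarrow> bit) \<Rightarrow> 'a list set" where
  "Col S p = super_columns S p - {[]}"

definition Col2 ::
    "'a::linorder set \<Rightarrow> ('a \<Rightarrow> bit) \<Rightarrow> ('a list list \<times> 'a list list) set" where
  "Col2 S p =
     {([u, v], [w, w']) | u v w w'. u \<in> Col S p \<and> v \<in> Col S p \<and>
        \<not> juxtaposition_tableau S p (insertion_tableau p u) (insertion_tableau p v) \<and>
        column_readings (insertion_tableau p (u @ v)) = [w, w']} \<union>
     {([u, v], [u @ v]) | u v. u \<in> Col S p \<and> v \<in> Col S p \<and>
        \<not> juxtaposition_tableau S p (insertion_tableau p u) (insertion_tableau p v) \<and>
        length (column_readings (insertion_tableau p (u @ v))) = 1}"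

end

theory Submission
  imports Defs "HOL-Library.Multiset"
begin

text \<open>
  Inserting a word row by row, a plactic relation between two inserted words either becomes an
  equality or is passed on to the words bumped into the next row. Hence the insertion tableau is
  an invariant of the plactic class. As it is reached by plactic moves, and inserting the column
  reading of a tableau gives the tableau back, every class contains the column reading of exactly
  one tableau.

  A word of columns is irreducible iff its adjacent pairs juxtapose, that is, iff it lists the
  columns of a tableau; so irreducible words are determined by their plactic class. The system
  terminates because inserting \<open>v\<close> into \<open>u\<close> can only lengthen the first column or decrease its
  entries, while the multiset of letters occurring in the word, which is finite, does not change.
\<close>

text \<open>The signs enter only through two relations: \<open>bumps p x y\<close> allows x directly
  above y in a column, and \<open>rowle p x y\<close>, the negated converse of \<open>bumps\<close>,
  allows x directly left of y in a row. Each is transitive, and composing one with the other gives a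
  strict inequality, hence both. With these rules the arguments for unsigned tableaux apply without
  distinguishing parities. Confluence involves no critical pairs. Termination reduces every word to
  an irreducible one, rewriting keeps the plactic class of the concatenation, and an irreducible
  word is recovered from that class; so all reductions of a word end alike. The same argument shows
  that the rules generate the whole plactic congruence on words of columns. Termination is measured
  relative to the letters of the starting word, because \<open>S\<close> may be infinite with an
  order that is not well-founded.\<close>

abbreviation rowle :: "('a::linorder \<Rightarrow> bit) \<Rightarrow> 'a \<Rightarrow> 'a \<Rightarrow> bool" where
  "rowle p x y \<equiv> \<not> bumps p y x"

lemma bumps_iff: "bumps p x y \<longleftrightarrow> x \<le> y \<and> (x = y \<longrightarrow> p x = 1)"
  by (cases x y rule: linorder_cases) (auto simp: bumps_def)

lemma rowle_iff: "rowle p x y \<longleftrightarrow> x \<le> y \<and> (x = y \<longrightarrow> p x = 0)"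
  by (cases x y rule: linorder_cases) (auto simp: bumps_def)

lemma bumps_trans: "bumps p x y \<Longrightarrow> bumps p y z \<Longrightarrow> bumps p x z"
  by (auto simp: bumps_iff)

lemma rowle_trans: "rowle p x y \<Longrightarrow> rowle p y z \<Longrightarrow> rowle p x z"
  by (auto simp: rowle_iff)

lemma rowle_bumps_less: "rowle p x y \<Longrightarrow> bumps p y z \<Longrightarrow> x < z"
  by (auto simp: rowle_iff bumps_iff less_le)

lemma bumps_rowle_less: "bumps p x y \<Longrightarrow> rowle p y z \<Longrightarrow> x < z"
  by (auto simp: rowle_iff bumps_iff less_le)

lemma less_bumps: "x < y \<Longrightarrow> bumps p x y"
  by (auto simp: bumps_iff)

lemma less_rowle: "x < y \<Longrightarrow> rowle p x y"
  by (auto simp: rowle_iff)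

lemmas mixed_trans =
  rowle_bumps_less[THEN less_bumps] rowle_bumps_less[THEN less_rowle]
  bumps_rowle_less[THEN less_bumps] bumps_rowle_less[THEN less_rowle]

section \<open>Insertion of words into a single row\<close>

definition row_insert :: "('a::linorder \<Rightarrow> bit) \<Rightarrow> 'a list \<Rightarrow> 'a \<Rightarrow> 'a list \<times> 'a list" where
  "row_insert p r x =
     (case dropWhile (\<lambda>y. \<not> bumps p x y) r of
        [] \<Rightarrow> (r @ [x], [])
      | y # ys \<Rightarrow> (takeWhile (\<lambda>y. \<not> bumps p x y) r @ x # ys, [y]))"

text \<open>The bumped letters are collected in the order in which they leave the row: they form the
  word that the next row receives.\<close>

fun row_insert_word :: "('a::linorder \<Rightarrow> bit) \<Rightarrow> 'a list \<Rightarrow> 'a list \<Rightarrow> 'a list \<times> 'a list" where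
  "row_insert_word p r [] = (r, [])"
| "row_insert_word p r (x # w) =
     (let (r1, v1) = row_insert p r x; (r2, v2) = row_insert_word p r1 w in (r2, v1 @ v2))"

lemma row_insert_append:
  "(\<forall>a\<in>set r. \<not> bumps p x a) \<Longrightarrow> row_insert p r x = (r @ [x], [])"
  by (simp add: row_insert_def dropWhile_eq_Nil_conv[THEN iffD2])

lemma row_insert_bump:
  assumes "\<forall>a\<in>set A. \<not> bumps p x a" "bumps p x y"
  shows "row_insert p (A @ y # B) x = (A @ x # B, [y])"
  using assms by (simp add: row_insert_def takeWhile_append2 dropWhile_append2)

lemma row_insert_cases [case_names append bump]:
  obtains "\<forall>a\<in>set r. \<not> bumps p x a"
  | A y B where "r = A @ y # B" "\<forall>a\<in>set A. \<not> bumps p x a" "bumps p x y"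
proof (cases "\<forall>a\<in>set r. \<not> bumps p x a")
  case False
  then have "\<exists>a\<in>set r. bumps p x a" by simp
  then show ?thesis using that(2) by (metis split_list_first_prop)
qed (use that in blast)

lemma right_insert_Cons:
  "right_insert p (r # rs) x =
     fst (row_insert p r x) # foldl (right_insert p) rs (snd (row_insert p r x))"
  by (cases "dropWhile (\<lambda>y. \<not> bumps p x y) r")
    (simp_all add: row_insert_def del: dropWhile_eq_Nil_conv)

text \<open>The lower rows see nothing of the inserted word but the letters bumped out of the top
  row. So a tableau can be processed row by row instead of letter by letter, which allows induction
  on the rows.\<close>

lemma foldl_right_insert_Cons:
  "foldl (right_insert p) (r # rs) w =
     fst (row_insert_word p r w) # foldl (right_insert p) rs (snd (row_insert_word p r w))"
  by (induction w arbitrary: r rs)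
    (simp_all add: right_insert_Cons Let_def split_beta del: right_insert.simps(2))

lemma row_insert_set:
  "set (fst (row_insert p r x)) \<union> set (snd (row_insert p r x)) = insert x (set r)"
  by (cases r p x rule: row_insert_cases) (auto simp: row_insert_append row_insert_bump)

lemma row_insert_sorted:
  assumes "sorted_wrt (rowle p) r"
  shows "sorted_wrt (rowle p) (fst (row_insert p r x))"
proof (cases r p x rule: row_insert_cases)
  case append
  then show ?thesis using assms by (auto simp: row_insert_append sorted_wrt_append)
next
  case (bump A y B)
  then show ?thesis using assms
    by (auto simp: row_insert_bump sorted_wrt_append dest: bumps_trans)
qed

lemma row_insert_snd: "snd (row_insert p r x) = [] \<or> (\<exists>y. snd (row_insert p r x) = [y])"
  by (simp add: row_insert_def split: list.splits)

lemma right_insert_rows_sorted: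
  assumes "\<forall>r\<in>set T. sorted_wrt (rowle p) r"
  shows "\<forall>r\<in>set (right_insert p T x). sorted_wrt (rowle p) r"
  using assms
proof (induction T arbitrary: x)
  case Nil
  then show ?case by simp
next
  case (Cons r rs)
  then show ?case using row_insert_sorted[of p r x] row_insert_snd[of p r x]
    by (auto simp: right_insert_Cons simp del: right_insert.simps(2))
qed

section \<open>Plactic invariance of insertion\<close>

text \<open>The plactic relations without the alphabet: the order and equality conditions are
  exactly one \<open>rowle\<close> and one \<open>bumps\<close> condition, and bumped letters need
  no membership argument.\<close>

inductive knuth :: "('a::linorder \<Rightarrow> bit) \<Rightarrow> 'a list \<Rightarrow> 'a list \<Rightarrow> bool" for p where
  knuth1: "rowle p x y \<Longrightarrow> bumps p y z \<Longrightarrow> knuth p [z, x, y] [x, z, y]"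
| knuth2: "bumps p x y \<Longrightarrow> rowle p y z \<Longrightarrow> knuth p [y, z, x] [y, x, z]"

text \<open>At most one elementary relation, in either direction. Symmetry is essential: a relation
  of the first kind can be passed to the next row as one of the second kind read backwards.\<close>

definition knuth_eq :: "('a::linorder \<Rightarrow> bit) \<Rightarrow> 'a list \<Rightarrow> 'a list \<Rightarrow> bool" where
  "knuth_eq p u v \<longleftrightarrow> u = v \<or> knuth p u v \<or> knuth p v u"

lemma row_insert_bump':
  assumes "\<forall>a\<in>set A. \<not> bumps p x a" "bumps p x y" "r = A @ y # B"
  shows "row_insert p r x = (A @ x # B, [y])"
  using assms by (simp add: row_insert_bump)

text \<open>If z is appended, both orders bump the same word. If z bumps z' and x lands further
  left, the bumped letters satisfy a relation of the first kind. If x also lands in the cell of z',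
  the entry b to its right decides: without it the bumped words agree, with it they form a reversed
  relation of the second kind.\<close>

lemma row_insert_word_knuth1:
  assumes s: "sorted_wrt (rowle p) r" and xy: "rowle p x y" and yz: "bumps p y z"
  shows "fst (row_insert_word p r [z, x, y]) = fst (row_insert_word p r [x, z, y]) \<and>
    knuth_eq p (snd (row_insert_word p r [z, x, y])) (snd (row_insert_word p r [x, z, y]))"
proof -
  have xz: "rowle p x z" "bumps p x z" by (fact mixed_trans(1,2)[OF xy yz])+
  have tr: "rowle p a x \<Longrightarrow> rowle p a y" "rowle p a x \<Longrightarrow> rowle p a z"
     "rowle p a y \<Longrightarrow> rowle p a z" for a
    by (fact rowle_trans[OF _ xy] rowle_trans[OF _ xz(1)] mixed_trans(2)[OF _ yz])+
  show ?thesis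
  proof (cases r p z rule: row_insert_cases)
    case append
    note z = append
    show ?thesis
    proof (cases r p x rule: row_insert_cases)
      case append
      have 1: "row_insert p (r @ [z]) x = (r @ [x], [z])"
        using append xz by (intro row_insert_bump) auto
      have 2: "row_insert p (r @ [x, z]) y = (r @ [x, y], [z])"
        using row_insert_bump[of "r @ [x]" p y z "[]"] append xy yz tr by auto
      show ?thesis using append z 1 2 xy xz tr by (simp add: row_insert_append knuth_eq_def)
    next
      case (bump A x' B)
      have A: "\<forall>a\<in>set A. rowle p a y" using bump tr by auto
      have 1: "row_insert p (r @ [z]) x = (A @ x # B @ [z], [x'])"
        using bump by (intro row_insert_bump') auto
      have 2: "row_insert p (A @ x # B) z = (A @ x # B @ [z], [])"
        using bump z xz by (subst row_insert_append) auto
      show ?thesis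
        using bump z 1 2 by (simp add: row_insert_append row_insert_bump knuth_eq_def split_beta)
    qed
  next
    case (bump A z' B)
    note z = bump
    have sA: "sorted_wrt (rowle p) A" "sorted_wrt (rowle p) B"
      "\<forall>a\<in>set A. rowle p a z'" "\<forall>b\<in>set B. rowle p z' b"
      using s z by (auto simp: sorted_wrt_append)
    have yz': "bumps p y z'" "bumps p x z'" using yz xz z by (blast intro: bumps_trans)+
    show ?thesis
    proof (cases A p x rule: row_insert_cases)
      case append
      have 1: "row_insert p (A @ z # B) x = (A @ x # B, [z])"
        using append xz by (intro row_insert_bump) auto
      have 2: "row_insert p r x = (A @ x # B, [z'])"
        using append z yz' by (simp add: row_insert_bump)
      show ?thesis
      proof (cases B)
        case Nil
        have 3: "row_insert p (A @ [x]) y = (A @ [x, y], [])"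
          using append xy tr by (subst row_insert_append) auto
        have 4: "row_insert p (A @ [x]) z = (A @ [x, z], [])"
          using append xz tr by (subst row_insert_append) auto
        have 5: "row_insert p (A @ [x, z]) y = (A @ [x, y], [z])"
          using append xy yz tr by (intro row_insert_bump'[of "A @ [x]", simplified]) auto
        show ?thesis using z 1 2 3 4 5 Nil by (simp add: row_insert_bump knuth_eq_def)
      next
        case (Cons b B')
        have b: "rowle p z' b" using sA Cons by simp
        have zb: "bumps p z b" "bumps p y b" using b z yz' by (auto intro: mixed_trans)
        have 3: "row_insert p (A @ x # B) y = (A @ x # y # B', [b])"
          using append xy tr zb Cons by (intro row_insert_bump'[of "A @ [x]", simplified]) auto
        have 4: "row_insert p (A @ x # B) z = (A @ x # z # B', [b])"
          using append xz tr zb Cons by (intro row_insert_bump'[of "A @ [x]", simplified]) auto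
        have 5: "row_insert p (A @ x # z # B') y = (A @ x # y # B', [z])"
          using append xy yz tr by (intro row_insert_bump'[of "A @ [x]", simplified]) auto
        have "knuth p [z', b, z] [z', z, b]" using z b by (intro knuth2)
        then show ?thesis using z 1 2 3 4 5 by (simp add: row_insert_bump knuth_eq_def)
      qed
    next
      case (bump A1 x' A2)
      have A1: "\<forall>a\<in>set A1. rowle p a y" using bump tr by auto
      have 1: "row_insert p (A @ z # B) x = (A1 @ x # A2 @ z # B, [x'])"
        using bump by (intro row_insert_bump') auto
      have 2: "row_insert p r x = (A1 @ x # A2 @ z' # B, [x'])"
        using bump z by (intro row_insert_bump') auto
      have 3: "row_insert p (A1 @ x # A2 @ z' # B) z = (A1 @ x # A2 @ z # B, [z'])"
        using bump z xz by (intro row_insert_bump'[of "A1 @ x # A2", simplified]) auto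
      \<comment> \<open>Both orders leave the same row, so y bumps the same third letter: z if y
        passes all of \<open>A2\<close>, otherwise an entry \<open>y'\<close> of
        \<open>A2\<close>.\<close>
      have "knuth p (z' # x' # snd (row_insert p (A1 @ x # A2 @ z # B) y))
                    (x' # z' # snd (row_insert p (A1 @ x # A2 @ z # B) y))"
      proof (cases A2 p y rule: row_insert_cases)
        case append
        have "row_insert p (A1 @ x # A2 @ z # B) y = (A1 @ x # A2 @ y # B, [z])"
          using append A1 xy yz by (intro row_insert_bump'[of "A1 @ x # A2", simplified]) auto
        then show ?thesis using z bump by (auto intro: knuth1)
      next
        case b: (bump A3 y' A4)
        have "row_insert p (A1 @ x # A2 @ z # B) y = (A1 @ x # A3 @ y # A4 @ z # B, [y'])"
          using b A1 xy yz by (intro row_insert_bump'[of "A1 @ x # A3", simplified]) auto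
        moreover have "rowle p x' y'" using sA bump b by (auto simp: sorted_wrt_append)
        moreover have "bumps p y' z'" using bump b z by (auto intro: mixed_trans)
        ultimately show ?thesis by (auto intro: knuth1)
      qed
      then show ?thesis using z 1 2 3 by (simp add: row_insert_bump knuth_eq_def split_beta)
    qed
  qed
qed

text \<open>After y has been inserted, x acts at or left of the cell of y and z strictly right of
  it. The two insertions do not interfere, so the rows agree and only the order of the letters
  bumped by x and z changes.\<close>

lemma row_insert_word_knuth2:
  assumes s: "sorted_wrt (rowle p) r" and xy: "bumps p x y" and yz: "rowle p y z"
  shows "fst (row_insert_word p r [y, z, x]) = fst (row_insert_word p r [y, x, z]) \<and>
    knuth_eq p (snd (row_insert_word p r [y, z, x])) (snd (row_insert_word p r [y, x, z]))"
proof -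
  have xz: "rowle p x z" "bumps p x z" by (fact mixed_trans(3,4)[OF xy yz])+
  have tr: "rowle p a x \<Longrightarrow> rowle p a y" "rowle p a x \<Longrightarrow> rowle p a z"
     "rowle p a y \<Longrightarrow> rowle p a z" for a
    by (fact mixed_trans(2)[OF _ xy] rowle_trans[OF _ xz(1)] rowle_trans[OF _ yz])+
  show ?thesis
  proof (cases r p y rule: row_insert_cases)
    case append
    note y = append
    have 0: "row_insert p (r @ [y]) z = (r @ [y, z], [])"
      using y yz tr by (subst row_insert_append) auto
    show ?thesis
    proof (cases r p x rule: row_insert_cases)
      case append
      have 1: "row_insert p (r @ [y, z]) x = (r @ [x, z], [y])"
        using append xy by (intro row_insert_bump) auto
      have 2: "row_insert p (r @ [y]) x = (r @ [x], [y])"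
        using append xy by (intro row_insert_bump) auto
      have 3: "row_insert p (r @ [x]) z = (r @ [x, z], [])"
        using y xz tr by (subst row_insert_append) auto
      show ?thesis using y 0 1 2 3 by (simp add: row_insert_append knuth_eq_def)
    next
      case (bump A x' B)
      have 1: "row_insert p (r @ [y, z]) x = (A @ x # B @ [y, z], [x'])"
        using bump by (intro row_insert_bump') auto
      have 2: "row_insert p (r @ [y]) x = (A @ x # B @ [y], [x'])"
        using bump by (intro row_insert_bump') auto
      have 3: "row_insert p (A @ x # B @ [y]) z = (A @ x # B @ [y, z], [])"
        using y xz yz tr bump by (subst row_insert_append) auto
      show ?thesis using y 0 1 2 3 by (simp add: row_insert_append knuth_eq_def)
    qed
  next
    case (bump A y' B)
    note y = bump
    have A: "\<forall>a\<in>set A. rowle p a z" using y tr by auto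
    \<comment> \<open>Whatever stands to the right as \<open>C\<close>, x changes only
      \<open>A @ [y]\<close>. One description thus serves both before and after the insertion of
      z.\<close>
    obtain A' x' where x: "\<And>C. row_insert p (A @ y # C) x = (A' @ C, [x'])"
      "bumps p x' y'" "\<forall>a\<in>set A'. rowle p a z"
    proof (cases A p x rule: row_insert_cases)
      case append
      have "row_insert p (A @ y # C) x = ((A @ [x]) @ C, [y])" for C
        using append xy by (simp add: row_insert_bump)
      then show ?thesis using that[of "A @ [x]" y] y A xz by auto
    next
      case (bump A1 x' A2)
      have "row_insert p (A @ y # C) x = ((A1 @ x # A2 @ [y]) @ C, [x'])" for C
        using bump xy by (simp add: row_insert_bump)
      moreover have "bumps p x' y'" using bump y by (auto intro: mixed_trans)
      ultimately show ?thesis using that[of "A1 @ x # A2 @ [y]" x'] y A xz yz bump by auto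
    qed
    show ?thesis
    proof (cases B p z rule: row_insert_cases)
      case append
      have 1: "row_insert p (A @ y # B) z = (A @ y # B @ [z], [])"
        using A append yz by (subst row_insert_append) auto
      have 2: "row_insert p (A' @ B) z = (A' @ B @ [z], [])"
        using x append yz by (subst row_insert_append) auto
      show ?thesis using y x 1 2 by (simp add: row_insert_bump knuth_eq_def)
    next
      case (bump B1 z' B2)
      have 1: "row_insert p (A @ y # B) z = (A @ y # B1 @ z # B2, [z'])"
        using A bump yz by (intro row_insert_bump'[of "A @ y # B1", simplified]) auto
      have 2: "row_insert p (A' @ B) z = (A' @ B1 @ z # B2, [z'])"
        using x bump by (intro row_insert_bump'[of "A' @ B1", simplified]) auto
      have "rowle p y' z'" using s y bump by (auto simp: sorted_wrt_append)
      then have "knuth p [y', z', x'] [y', x', z']" using x by (intro knuth2)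
      then show ?thesis using y x 1 2 by (simp add: row_insert_bump knuth_eq_def)
    qed
  qed
qed

lemma row_insert_word_knuth_eq:
  assumes "sorted_wrt (rowle p) r" "knuth_eq p u v"
  shows "fst (row_insert_word p r u) = fst (row_insert_word p r v) \<and>
    knuth_eq p (snd (row_insert_word p r u)) (snd (row_insert_word p r v))"
proof -
  have *: "fst (row_insert_word p r u) = fst (row_insert_word p r v) \<and>
    knuth_eq p (snd (row_insert_word p r u)) (snd (row_insert_word p r v))"
    if "knuth p u v" for u v
    using that
  proof cases
    case knuth1
    then show ?thesis using row_insert_word_knuth1[OF assms(1)] by blast
  next
    case knuth2
    then show ?thesis using row_insert_word_knuth2[OF assms(1)] by blast
  qed
  from assms(2) consider "u = v" | "knuth p u v" | "knuth p v u" by (auto simp: knuth_eq_def)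
  then show ?thesis
    using *[of u v] *[of v u] unfolding knuth_eq_def by cases metis+
qed

lemma foldl_right_insert_Nil_knuth:
  assumes "knuth p u v"
  shows "foldl (right_insert p) [] u = foldl (right_insert p) [] v"
  using assms
proof cases
  case (knuth1 x y z)
  then have "bumps p x z" "rowle p x z" by (metis mixed_trans(1,2))+
  then show ?thesis using knuth1 by simp
next
  case (knuth2 x y z)
  then have "bumps p x z" "rowle p x z" by (metis mixed_trans(3,4))+
  then show ?thesis using knuth2 by simp
qed

text \<open>The words vary in the induction because each row hands its bumped words, again related
  by \<open>knuth_eq\<close>, to the rows below.\<close>

lemma foldl_right_insert_knuth_eq:
  assumes "\<forall>r\<in>set T. sorted_wrt (rowle p) r" "knuth_eq p u v"
  shows "foldl (right_insert p) T u = foldl (right_insert p) T v"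
  using assms
proof (induction T arbitrary: u v)
  case Nil
  then show ?case using foldl_right_insert_Nil_knuth[of p] by (auto simp: knuth_eq_def)
next
  case (Cons r rs)
  then show ?case
    using row_insert_word_knuth_eq[of p r u v] by (simp add: foldl_right_insert_Cons)
qed

lemma super_plactic_relations_knuth:
  "(u, v) \<in> super_plactic_relations S p \<longleftrightarrow> knuth p u v \<and> u \<in> lists S \<and> v \<in> lists S"
  (is "?l = ?r")
proof
  assume ?l
  then show ?r
    by (auto simp: super_plactic_relations_def rowle_iff bumps_iff intro!: knuth.intros)
next
  assume ?r
  then have "knuth p u v" "u \<in> lists S" "v \<in> lists S" by auto
  then show ?l
    by (cases rule: knuth.cases)
      (auto simp: super_plactic_relations_def rowle_iff bumps_iff)
qed

abbreviation plactic :: "'a::linorder set \<Rightarrow> ('a \<Rightarrow> bit) \<Rightarrow> 'a list \<Rightarrow> 'a list \<Rightarrow> bool" where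
  "plactic S p \<equiv> gen_cong S (super_plactic_relations S p)"

lemma foldl_right_insert_rows_sorted:
  "\<forall>r\<in>set T. sorted_wrt (rowle p) r \<Longrightarrow>
   \<forall>r\<in>set (foldl (right_insert p) T w). sorted_wrt (rowle p) r"
  by (induction w arbitrary: T) (auto dest: right_insert_rows_sorted)

text \<open>The starting tableau is arbitrary because in a concatenation the second factor is
  inserted into the tableau left by the first.\<close>

lemma plactic_foldl_right_insert:
  assumes "plactic S p u v" "\<forall>r\<in>set T. sorted_wrt (rowle p) r"
  shows "foldl (right_insert p) T u = foldl (right_insert p) T v"
  using assms
proof (induction arbitrary: T rule: gen_cong.induct)
  case (base u v)
  then show ?case
    by (intro foldl_right_insert_knuth_eq)
      (auto simp: knuth_eq_def super_plactic_relations_knuth)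
next
  case (append u v u' v')
  have "foldl (right_insert p) T u = foldl (right_insert p) T v" using append by blast
  then show ?case
    using append.IH(2)[OF foldl_right_insert_rows_sorted[OF append.prems, of v]] by simp
qed auto

lemma plactic_insertion_tableau:
  "plactic S p u v \<Longrightarrow> insertion_tableau p u = insertion_tableau p v"
  unfolding insertion_tableau_def by (rule plactic_foldl_right_insert) auto

lemma plactic_mset: "plactic S p u v \<Longrightarrow> mset u = mset v"
proof (induction rule: gen_cong.induct)
  case (base u v)
  then show ?case by (auto simp: super_plactic_relations_def)
qed auto

section \<open>Insertion computes plactic normal forms\<close>

text \<open>Rows are read from bottom to top. A letter bumped out of a row to its left then stands
  at the end of the reading of the rows below, ready to be inserted there.\<close>

definition row_reading :: "'a list list \<Rightarrow> 'a list" where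
  "row_reading T = concat (rev T)"

lemma plactic_append_left: "plactic S p u v \<Longrightarrow> a \<in> lists S \<Longrightarrow> plactic S p (a @ u) (a @ v)"
  by (auto intro: gen_cong.append gen_cong.refl)

lemma plactic_append_right: "plactic S p u v \<Longrightarrow> b \<in> lists S \<Longrightarrow> plactic S p (u @ b) (v @ b)"
  by (auto intro: gen_cong.append gen_cong.refl)

lemma plactic_knuth: "knuth p u v \<Longrightarrow> u \<in> lists S \<Longrightarrow> v \<in> lists S \<Longrightarrow> plactic S p u v"
  by (auto intro!: gen_cong.base simp: super_plactic_relations_knuth)

text \<open>The letter x passes each b of \<open>B\<close> by a relation of the second kind, with
  the left neighbour of b as the fixed first letter; x bumps all of these neighbours.\<close>

lemma plactic_move_left:
  assumes "sorted_wrt (rowle p) (y # B)" "bumps p x y" "set (y # B) \<subseteq> S" "x \<in> S"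
  shows "plactic S p (y # B @ [x]) (y # x # B)"
  using assms
proof (induction B arbitrary: y)
  case Nil
  then show ?case by (auto intro: gen_cong.refl)
next
  case (Cons b B)
  have xb: "bumps p x b" using Cons.prems by (auto intro: mixed_trans)
  have "plactic S p (b # B @ [x]) (b # x # B)" using Cons xb by auto
  then have "plactic S p ([y] @ (b # B @ [x])) ([y] @ (b # x # B))"
    using Cons by (intro plactic_append_left) auto
  moreover have "plactic S p ([y, b, x] @ B) ([y, x, b] @ B)"
    using Cons by (intro plactic_append_right plactic_knuth knuth.intros) auto
  ultimately show ?case by (auto intro: gen_cong.trans)
qed

text \<open>The letter y passes the last letter a of \<open>A\<close> by a relation of the first
  kind, with x as the fixed last letter. Then a takes over the role of x, which is why x is
  generalised.\<close>

lemma plactic_move_right: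
  assumes "sorted_wrt (rowle p) A" "\<forall>a\<in>set A. rowle p a x" "bumps p x y"
    "set A \<subseteq> S" "x \<in> S" "y \<in> S"
  shows "plactic S p (A @ [y, x]) (y # A @ [x])"
  using assms
proof (induction A arbitrary: x rule: rev_induct)
  case Nil
  then show ?case by (auto intro: gen_cong.refl)
next
  case (snoc a A)
  have "bumps p a y" using snoc.prems by (auto intro: mixed_trans)
  then have "plactic S p (A @ [y, a]) (y # A @ [a])"
    using snoc by (auto simp: sorted_wrt_append)
  then have "plactic S p ((A @ [y, a]) @ [x]) ((y # A @ [a]) @ [x])"
    using snoc.prems by (intro plactic_append_right) auto
  moreover have "plactic S p (A @ [a, y, x]) (A @ [y, a, x])"
    using snoc.prems
    by (intro plactic_append_left plactic_knuth[THEN gen_cong.sym] knuth.intros) auto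
  ultimately show ?case by (auto intro: gen_cong.trans)
qed

text \<open>Bumping is simulated in two moves: x travels left to the cell just after y, then y
  travels left out of the row.\<close>

lemma plactic_row_insert:
  assumes "sorted_wrt (rowle p) r" "r \<in> lists S" "x \<in> S"
  shows "plactic S p (r @ [x]) (snd (row_insert p r x) @ fst (row_insert p r x))"
proof (cases r p x rule: row_insert_cases)
  case append
  then show ?thesis using assms by (auto simp: row_insert_append intro!: gen_cong.refl)
next
  case (bump A y B)
  have "plactic S p (A @ (y # B @ [x])) (A @ (y # x # B))"
    using bump assms by (intro plactic_append_left plactic_move_left) (auto simp: sorted_wrt_append)
  moreover have "plactic S p ((A @ [y, x]) @ B) ((y # A @ [x]) @ B)"
    using bump assms
    by (intro plactic_append_right plactic_move_right) (auto simp: sorted_wrt_append)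
  ultimately show ?thesis using bump by (auto simp: row_insert_bump intro: gen_cong.trans)
qed

lemma plactic_row_reading_right_insert:
  assumes "\<forall>r\<in>set T. sorted_wrt (rowle p) r \<and> r \<in> lists S" "x \<in> S"
  shows "plactic S p (row_reading T @ [x]) (row_reading (right_insert p T x))"
  using assms
proof (induction T arbitrary: x)
  case Nil
  then show ?case by (auto simp: row_reading_def intro: gen_cong.refl)
next
  case (Cons r rs)
  let ?r = "fst (row_insert p r x)" and ?v = "snd (row_insert p r x)"
  have S: "set ?r \<union> set ?v \<subseteq> S"
    using Cons.prems row_insert_set[of p r x] by auto
  have rs: "row_reading rs \<in> lists S" using Cons.prems by (fastforce simp: row_reading_def)
  have "plactic S p (row_reading rs @ (r @ [x])) (row_reading rs @ (?v @ ?r))"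
    using Cons.prems rs by (intro plactic_append_left plactic_row_insert) auto
  moreover have "plactic S p ((row_reading rs @ ?v) @ ?r)
      (row_reading (foldl (right_insert p) rs ?v) @ ?r)"
    using row_insert_snd[of p r x]
  proof
    assume "?v = []"
    then show ?thesis using S rs by (auto intro!: gen_cong.refl)
  next
    assume "\<exists>y. ?v = [y]"
    then obtain y where "?v = [y]" ..
    then show ?thesis using S Cons by (intro plactic_append_right) auto
  qed
  ultimately show ?case
    by (auto simp: row_reading_def right_insert_Cons simp del: right_insert.simps(2)
        intro: gen_cong.trans)
qed

section \<open>Insertion preserves super tableaux\<close>

lemma super_tableau_Nil: "super_tableau S p []"
  by (simp add: super_tableau_def)

text \<open>The condition for \<open>s\<close> to be the row directly below \<open>r\<close>; it
  turns the vertical conditions into conditions on consecutive rows, matching insertion by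
  rows.\<close>

definition column_dominates :: "('a::linorder \<Rightarrow> bit) \<Rightarrow> 'a list \<Rightarrow> 'a list \<Rightarrow> bool" where
  "column_dominates p r s \<longleftrightarrow>
     length s \<le> length r \<and> (\<forall>j<length s. bumps p (r ! j) (s ! j))"

lemma sorted_rowle_iff_nth_Suc:
  "sorted_wrt (rowle p) r \<longleftrightarrow> (\<forall>j. Suc j < length r \<longrightarrow> rowle p (r ! j) (r ! Suc j))"
  by (rule sorted_wrt_iff_nth_Suc_transp) (auto simp: transp_on_def dest: rowle_trans)

lemma sorted_bumps_iff_nth_Suc:
  "sorted_wrt (bumps p) r \<longleftrightarrow> (\<forall>j. Suc j < length r \<longrightarrow> bumps p (r ! j) (r ! Suc j))"
  by (rule sorted_wrt_iff_nth_Suc_transp) (auto simp: transp_on_def dest: bumps_trans)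

lemma super_tableau_iff:
  "super_tableau S p T \<longleftrightarrow>
     (\<forall>r\<in>set T. r \<noteq> [] \<and> r \<in> lists S \<and> sorted_wrt (rowle p) r) \<and>
     (\<forall>i. Suc i < length T \<longrightarrow> column_dominates p (T ! i) (T ! Suc i))"
proof -
  have "(\<forall>r\<in>set T. sorted_wrt (rowle p) r) \<longleftrightarrow>
      (\<forall>i j. i < length T \<and> Suc j < length (T ! i) \<longrightarrow>
        T ! i ! j \<le> T ! i ! Suc j \<and> (T ! i ! j = T ! i ! Suc j \<longrightarrow> p (T ! i ! j) = 0))"
    unfolding all_set_conv_all_nth sorted_rowle_iff_nth_Suc
    unfolding rowle_iff by blast
  moreover have "(\<forall>i. Suc i < length T \<longrightarrow> column_dominates p (T ! i) (T ! Suc i)) \<longleftrightarrow>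
      (\<forall>i. Suc i < length T \<longrightarrow> length (T ! Suc i) \<le> length (T ! i)) \<and>
      (\<forall>i j. Suc i < length T \<and> j < length (T ! Suc i) \<longrightarrow>
        T ! i ! j \<le> T ! Suc i ! j \<and> (T ! i ! j = T ! Suc i ! j \<longrightarrow> p (T ! i ! j) = 1))"
    unfolding column_dominates_def bumps_iff by blast
  moreover have "[] \<notin> set T \<longleftrightarrow> (\<forall>r\<in>set T. r \<noteq> [])"
    by metis
  ultimately show ?thesis
    unfolding super_tableau_def by (simp only: ball_conj_distrib) argo
qed

lemma super_tableau_Cons:
  "super_tableau S p (r # rs) \<longleftrightarrow>
     r \<noteq> [] \<and> r \<in> lists S \<and> sorted_wrt (rowle p) r \<and>
     (rs \<noteq> [] \<longrightarrow> column_dominates p r (hd rs)) \<and> super_tableau S p rs"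
proof -
  have split: "(\<forall>i. P i) \<longleftrightarrow> P 0 \<and> (\<forall>i. P (Suc i))" for P :: "nat \<Rightarrow> bool"
    by (metis not0_implies_Suc)
  have "(\<forall>i. Suc i < length (r # rs) \<longrightarrow> column_dominates p ((r # rs) ! i) ((r # rs) ! Suc i))
    \<longleftrightarrow> (rs \<noteq> [] \<longrightarrow> column_dominates p r (hd rs)) \<and>
       (\<forall>i. Suc i < length rs \<longrightarrow> column_dominates p (rs ! i) (rs ! Suc i))"
    by (subst split) (auto simp: hd_conv_nth)
  then show ?thesis unfolding super_tableau_iff by auto
qed

text \<open>A bumped letter never moves to the right: the entry below the old cell of y, if any, is
  itself bumped by y. So y lands in a column of index at most \<open>length A\<close>, and there the
  new upper row has an entry of \<open>A\<close> or x, both admissible above y.\<close>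

lemma column_dominates_bump:
  assumes dom: "column_dominates p (A @ y # B) s"
    and A: "\<forall>a\<in>set A. rowle p a x" and xy: "bumps p x y"
  shows "column_dominates p (A @ x # B) (fst (row_insert p s y))"
proof -
  let ?r = "A @ y # B" and ?r' = "A @ x # B"
  have le: "length s \<le> length ?r" and d: "\<And>j. j < length s \<Longrightarrow> bumps p (?r ! j) (s ! j)"
    using dom by (auto simp: column_dominates_def)
  have 1: "bumps p (?r' ! j) y" if "j \<le> length A" for j
    using that A xy by (auto simp: nth_append le_less intro: mixed_trans)
  have 2: "bumps p (?r' ! j) (s ! j)" if "j < length s" for j
    using d[OF that] xy by (auto simp: nth_append nth_Cons' split: if_splits dest: bumps_trans)
  \<comment> \<open>\<open>C\<close> is the part of \<open>s\<close> that y passes. Were it longer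
    than \<open>A\<close>, it would contain the entry below the old cell of y, which y
    bumps.\<close>
  have 3: "length C \<le> length A" if "\<forall>a\<in>set C. rowle p a y" "s = C @ D" for C D
  proof (rule ccontr)
    assume "\<not> length C \<le> length A"
    then have "bumps p y (s ! length A)" "s ! length A \<in> set C"
      using d[of "length A"] that by (auto simp: nth_append)
    then show False using that by blast
  qed
  show ?thesis
  proof (cases s p y rule: row_insert_cases)
    case append
    then show ?thesis using 1 2 3[of s "[]"]
      by (auto simp: row_insert_append column_dominates_def nth_append less_Suc_eq)
  next
    case (bump C z D)
    have "bumps p (?r' ! j) ((C @ y # D) ! j)" if "j < length s" for j
    proof (cases "j = length C")
      case True
      then show ?thesis using 1 3[of C "z # D"] bump by auto
    next
      case False
      then have "(C @ y # D) ! j = s ! j" using bump by (auto simp: nth_append nth_Cons')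
      then show ?thesis using 2 that by simp
    qed
    then show ?thesis using bump le by (auto simp: row_insert_bump column_dominates_def)
  qed
qed

lemma super_tableau_right_insert:
  assumes "super_tableau S p T" "x \<in> S"
  shows "super_tableau S p (right_insert p T x)"
  using assms
proof (induction T arbitrary: x)
  case Nil
  then show ?case by (simp add: super_tableau_Cons super_tableau_Nil)
next
  case (Cons r rs)
  note T = Cons.prems(1)[unfolded super_tableau_Cons]
  have S: "set (fst (row_insert p r x)) \<union> set (snd (row_insert p r x)) \<subseteq> S"
    using Cons.prems(2) T row_insert_set[of p r x] by auto
  have s: "sorted_wrt (rowle p) (fst (row_insert p r x))"
    using T by (auto intro: row_insert_sorted)
  show ?case
  proof (cases r p x rule: row_insert_cases)
    case append
    then show ?thesis using T S s
      by (auto simp: right_insert_Cons super_tableau_Cons row_insert_append column_dominates_def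
          nth_append simp del: right_insert.simps(2))
  next
    case (bump A y B)
    have ri: "row_insert p r x = (A @ x # B, [y])" using bump by (simp add: row_insert_bump)
    have "super_tableau S p (right_insert p rs y)" using Cons.IH T S ri by auto
    moreover have "column_dominates p (A @ x # B) (hd (right_insert p rs y))"
    proof (cases rs)
      case Nil
      have "bumps p ((A @ [x]) ! 0) y" using bump by (cases A) (auto intro: mixed_trans)
      then show ?thesis using Nil by (cases A) (auto simp: column_dominates_def)
    next
      case (Cons s ss)
      then show ?thesis using T bump column_dominates_bump[of p A y B s x]
        by (auto simp: right_insert_Cons simp del: right_insert.simps(2))
    qed
    ultimately show ?thesis using S s ri
      by (auto simp: right_insert_Cons super_tableau_Cons simp del: right_insert.simps(2))
  qed
qed

lemma insertion_tableau_snoc: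
  "insertion_tableau p (w @ [x]) = right_insert p (insertion_tableau p w) x"
  by (simp add: insertion_tableau_def)

lemma super_tableau_insertion_tableau:
  "w \<in> lists S \<Longrightarrow> super_tableau S p (insertion_tableau p w)"
  by (induction w rule: rev_induct)
    (auto simp: insertion_tableau_snoc super_tableau_right_insert super_tableau_Nil
      insertion_tableau_def[of p "[]"])

lemma plactic_row_reading:
  "w \<in> lists S \<Longrightarrow> plactic S p w (row_reading (insertion_tableau p w))"
proof (induction w rule: rev_induct)
  case Nil
  then show ?case by (auto simp: insertion_tableau_def row_reading_def intro: gen_cong.refl)
next
  case (snoc x w)
  let ?T = "insertion_tableau p w"
  have "plactic S p (w @ [x]) (row_reading ?T @ [x])"
    using snoc by (intro plactic_append_right) auto
  moreover have "plactic S p (row_reading ?T @ [x]) (row_reading (right_insert p ?T x))"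
    using super_tableau_insertion_tableau[of w S p] snoc.prems
    by (intro plactic_row_reading_right_insert) (auto simp: super_tableau_iff)
  ultimately show ?case by (auto simp: insertion_tableau_snoc intro: gen_cong.trans)
qed

section \<open>Columns\<close>

text \<open>Here \<open>c\<close> and \<open>d\<close> are columns listed from top to bottom, hence reversed super columns.\<close>

definition juxtaposable :: "('a::linorder \<Rightarrow> bit) \<Rightarrow> 'a list \<Rightarrow> 'a list \<Rightarrow> bool" where
  "juxtaposable p c d \<longleftrightarrow> length d \<le> length c \<and> (\<forall>i<length d. rowle p (c ! i) (d ! i))"

lemma juxtaposable_trans: "juxtaposable p c d \<Longrightarrow> juxtaposable p d e \<Longrightarrow> juxtaposable p c e"
  unfolding juxtaposable_def by (metis order.strict_trans2 order.trans rowle_trans)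

lemma super_column_iff: "super_column p u \<longleftrightarrow> sorted_wrt (bumps p) (rev u)"
proof -
  have "sorted_wrt (bumps p) (rev u) \<longleftrightarrow> successively (bumps p) (rev u)"
    by (rule successively_conv_sorted_wrt[symmetric])
      (auto simp: transp_on_def dest: bumps_trans)
  moreover have "(\<lambda>x y. y \<le> x \<and> (x = y \<longrightarrow> p x = 1)) = (\<lambda>x y. bumps p y x)"
    by (auto simp: bumps_iff fun_eq_iff)
  ultimately show ?thesis
    unfolding super_column_def by (simp only: successively_rev)
qed

text \<open>Letters beyond the last row open new rows, so the first column, added to the empty
  tableau, is covered as well.\<close>

fun add_column :: "'a list list \<Rightarrow> 'a list \<Rightarrow> 'a list list" where
  "add_column T [] = T"
| "add_column [] (c # cs) = [c] # add_column [] cs"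
| "add_column (r # rs) (c # cs) = (r @ [c]) # add_column rs cs"

lemma row_insert_word_append:
  "row_insert_word p r (u @ v) =
     (fst (row_insert_word p (fst (row_insert_word p r u)) v),
      snd (row_insert_word p r u) @ snd (row_insert_word p (fst (row_insert_word p r u)) v))"
  by (induction u arbitrary: r) (simp_all add: Let_def split_beta)

text \<open>Inserted from bottom to top, each letter of the column bumps its predecessor out of the
  same new end cell. Only the top letter c stays; the others are passed on in unchanged
  order.\<close>

lemma row_insert_word_column:
  assumes "sorted_wrt (bumps p) (c # cs)" "\<forall>a\<in>set r. rowle p a c"
  shows "row_insert_word p r (rev (c # cs)) = (r @ [c], rev cs)"
  using assms
proof (induction cs arbitrary: c)
  case Nil
  then show ?case by (simp add: row_insert_append)
next
  case (Cons d cs)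
  have "\<forall>a\<in>set r. rowle p a d" using Cons.prems by (auto dest: bumps_trans)
  then have "row_insert_word p r (rev (d # cs)) = (r @ [d], rev cs)"
    using Cons by auto
  moreover have "row_insert p (r @ [d]) c = (r @ [c], [d])"
    using Cons.prems by (intro row_insert_bump) auto
  ultimately have "row_insert_word p r (rev (d # cs) @ [c]) = (r @ [c], rev cs @ [d])"
    by (simp add: row_insert_word_append del: rev.simps)
  then show ?case by simp
qed

text \<open>An empty first row makes the row recursion applicable to the empty tableau.\<close>

lemma foldl_right_insert_Nil:
  "w \<noteq> [] \<Longrightarrow> foldl (right_insert p) [] w = foldl (right_insert p) [[]] w"
  by (cases w) auto

lemma foldl_right_insert_column:
  assumes "sorted_wrt (bumps p) c"
    "\<And>i. i < length T \<Longrightarrow> i < length c \<Longrightarrow> \<forall>a\<in>set (T ! i). rowle p a (c ! i)"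
  shows "foldl (right_insert p) T (rev c) = add_column T c"
  using assms
proof (induction T c rule: add_column.induct)
  case (2 c cs)
  then show ?case using row_insert_word_column[of p c cs "[]"]
    by (simp add: foldl_right_insert_Nil foldl_right_insert_Cons del: rev.simps)
next
  case (3 r rs c cs)
  have "\<forall>a\<in>set (rs ! i). rowle p a (cs ! i)" if "i < length rs" "i < length cs" for i
    using 3(3)[of "Suc i"] that by auto
  then show ?case using 3 row_insert_word_column[of p c cs r] 3(3)[of 0]
    by (simp add: foldl_right_insert_Cons del: rev.simps)
qed simp

section \<open>Tableaux as sequences of columns\<close>

lemma length_add_column: "length (add_column T c) = max (length T) (length c)"
  by (induction T c rule: add_column.induct) auto

lemma nth_add_column:
  assumes "i < max (length T) (length c)"
  shows "add_column T c ! i =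
    (if i < length T then T ! i else []) @ (if i < length c then [c ! i] else [])"
  using assms
  by (induction T c arbitrary: i rule: add_column.induct) (auto simp: nth_Cons split: nat.split)

text \<open>A missing row counts as empty, the same default as in
  \<open>nth_add_column\<close>.\<close>

lemma nth_transpose':
  "(if i < length (transpose cs) then transpose cs ! i else []) =
    map (\<lambda>c. c ! i) (filter (\<lambda>c. i < length c) cs)"
proof (cases "i < length (transpose cs)")
  case False
  have "length c \<le> foldr (\<lambda>xs. max (length xs)) cs 0" if "c \<in> set cs" for c
    using that by (induction cs) auto
  then have "filter (\<lambda>c. i < length c) cs = []"
    using False by (force simp: length_transpose filter_empty_conv)
  then show ?thesis using False by simp
qed (simp add: nth_transpose)

lemma transpose_snoc: "transpose (cs @ [c]) = add_column (transpose cs) c"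
proof -
  have "foldr (\<lambda>xs. max (length xs)) cs (length c) =
      max (foldr (\<lambda>xs. max (length xs)) cs 0) (length c)"
    by (induction cs) auto
  then have len: "length (transpose (cs @ [c])) = max (length (transpose cs)) (length c)"
    by (simp add: length_transpose)
  show ?thesis
  proof (rule nth_equalityI)
    fix i assume "i < length (transpose (cs @ [c]))"
    then show "transpose (cs @ [c]) ! i = add_column (transpose cs) c ! i"
      using nth_transpose'[of i cs] len by (subst nth_add_column) (auto simp: nth_transpose)
  qed (simp add: len length_add_column)
qed

text \<open>Every entry already in row i comes from a column juxtaposable with the new one, so the
  new letters bump only lower letters of their own column.\<close>

lemma insertion_tableau_columns:
  assumes "sorted_wrt (juxtaposable p) cs" "\<forall>c\<in>set cs. sorted_wrt (bumps p) c"
  shows "insertion_tableau p (concat (map rev cs)) = transpose cs"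
  using assms
proof (induction cs rule: rev_induct)
  case Nil
  then show ?case by (simp add: insertion_tableau_def)
next
  case (snoc c cs)
  have "\<forall>a\<in>set (transpose cs ! i). rowle p a (c ! i)"
    if "i < length (transpose cs)" "i < length c" for i
    using snoc.prems that by (auto simp: nth_transpose sorted_wrt_append juxtaposable_def)
  then have "foldl (right_insert p) (transpose cs) (rev c) = add_column (transpose cs) c"
    using snoc.prems by (intro foldl_right_insert_column) auto
  then show ?case using snoc
    by (simp add: insertion_tableau_def transpose_snoc sorted_wrt_append)
qed

lemma super_tableau_sorted:
  "super_tableau S p T \<Longrightarrow> sorted (rev (map length T))"
  by (auto simp: super_tableau_def sorted_rev_iff_nth_Suc)

text \<open>Row lengths decrease weakly, so the rows that reach column j form an initial segment and
  entry i of that column comes from row i.\<close>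

lemma nth_transpose_super_tableau:
  assumes T: "super_tableau S p T" and j: "j < length (transpose T)"
    and i: "i < length (transpose T ! j)"
  shows "i < length T" "j < length (T ! i)" "transpose T ! j ! i = T ! i ! j"
proof -
  have l: "length (transpose T ! j) = length (filter (\<lambda>r. j < length r) T)"
    using j by (simp add: nth_transpose)
  have f: "filter (\<lambda>r. j < length r) T = takeWhile (\<lambda>r. j < length r) T"
    by (rule filter_equals_takeWhile_sorted_rev[OF super_tableau_sorted[OF T]])
  show "transpose T ! j ! i = T ! i ! j"
    using super_tableau_sorted[OF T] j i l by (intro nth_nth_transpose_sorted) auto
  have i': "i < length (takeWhile (\<lambda>r. j < length r) T)" using i l f by simp
  then show "i < length T" using length_takeWhile_le[of "\<lambda>r. j < length r" T] by linarith
  show "j < length (T ! i)"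
    using nth_length_takeWhile takeWhile_nth[OF i'] nth_mem[OF i'] by (auto dest: set_takeWhileD)
qed

text \<open>Sorted rows relate any two columns, and dominance between consecutive rows makes each
  column a super column. Transposition is involutive here because row lengths decrease weakly and no
  row is empty.\<close>

lemma super_tableau_columns:
  assumes T: "super_tableau S p T"
  shows "sorted_wrt (juxtaposable p) (transpose T)"
    and "\<forall>c\<in>set (transpose T). rev c \<in> Col S p"
    and "transpose (transpose T) = T"
proof -
  note nth = nth_transpose_super_tableau[OF T]
  have row: "rowle p (T ! i ! j) (T ! i ! k)" if "i < length T" "j < k" "k < length (T ! i)" for i j k
    using T that by (auto simp: super_tableau_iff sorted_wrt_iff_nth_less)
  show "sorted_wrt (juxtaposable p) (transpose T)"
    unfolding sorted_wrt_iff_nth_less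
  proof (intro allI impI)
    fix j k assume jk: "j < k" "k < length (transpose T)"
    have len: "length (transpose T ! k) \<le> length (transpose T ! j)"
      using sorted_transpose[of T] jk by (auto simp: sorted_rev_iff_nth_mono)
    moreover have "rowle p (transpose T ! j ! i) (transpose T ! k ! i)"
      if "i < length (transpose T ! k)" for i
      using nth[of k i] nth[of j i] row[of i j k] jk len that by auto
    ultimately show "juxtaposable p (transpose T ! j) (transpose T ! k)"
      by (auto simp: juxtaposable_def)
  qed
  show "transpose (transpose T) = T"
    using T super_tableau_sorted[OF T]
    by (simp add: transpose_transpose takeWhile_eq_all_conv[THEN iffD2] super_tableau_iff)
  show "\<forall>c\<in>set (transpose T). rev c \<in> Col S p"
  proof
    fix c assume "c \<in> set (transpose T)"
    then obtain j where j: "j < length (transpose T)" "c = transpose T ! j"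
      by (auto simp: in_set_conv_nth)
    have "sorted_wrt (bumps p) c"
      unfolding sorted_bumps_iff_nth_Suc
    proof (intro allI impI)
      fix i assume "Suc i < length c"
      then show "bumps p (c ! i) (c ! Suc i)"
        using nth[OF j(1), of i] nth[OF j(1), of "Suc i"] T j(2)
        by (auto simp: super_tableau_iff column_dominates_def)
    qed
    moreover have "x \<in> S" if x: "x \<in> set c" for x
    proof -
      obtain i where "i < length c" "x = c ! i" using x by (auto simp: in_set_conv_nth)
      then have i: "i < length T" "j < length (T ! i)" "x = T ! i ! j"
        using nth[OF j(1), folded j(2)] by metis+
      then have "set (T ! i) \<subseteq> S" using T by (auto simp: super_tableau_iff)
      then show ?thesis using i nth_mem by blast
    qed
    \<comment> \<open>The number of columns is the length of the top row, so the top row reaches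
      column j.\<close>
    moreover have "c \<noteq> []"
    proof
      assume "c = []"
      then have "filter (\<lambda>r. j < length r) T = []" using j by (simp add: nth_transpose)
      moreover have "T \<noteq> []" "j < length (T ! 0)"
        using j length_transpose_sorted[OF super_tableau_sorted[OF T]] by (auto split: if_splits)
      ultimately show False by (cases T) auto
    qed
    ultimately show "rev c \<in> Col S p"
      by (auto simp: Col_def super_columns_def super_column_iff)
  qed
qed

lemma insertion_tableau_column_readings:
  assumes "super_tableau S p T"
  shows "insertion_tableau p (concat (column_readings T)) = T"
  using super_tableau_columns[OF assms] insertion_tableau_columns[of p "transpose T"]
  by (auto simp: column_readings_def Col_def super_columns_def super_column_iff)

lemma column_readings_Col: "super_tableau S p T \<Longrightarrow> column_readings T \<in> lists (Col S p)"
  using super_tableau_columns(2)[of S p T] by (auto simp: column_readings_def)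

lemma Col_lists: "U \<in> lists (Col S p) \<Longrightarrow> concat U \<in> lists S"
  by (fastforce simp: Col_def super_columns_def)

text \<open>The word and the column reading insert to the same tableau, and each is congruent to the
  row reading of that tableau.\<close>

lemma plactic_column_readings:
  assumes "w \<in> lists S"
  shows "plactic S p w (concat (column_readings (insertion_tableau p w)))" (is "plactic S p w ?v")
proof -
  have T: "super_tableau S p (insertion_tableau p w)"
    using assms by (rule super_tableau_insertion_tableau)
  have "?v \<in> lists S" using column_readings_Col[OF T] by (rule Col_lists)
  then have "plactic S p ?v (row_reading (insertion_tableau p w))"
    using plactic_row_reading insertion_tableau_column_readings[OF T] by metis
  then show ?thesis using plactic_row_reading[OF assms] by (blast intro: gen_cong.sym gen_cong.trans)
qed

section \<open>Juxtaposition and product of two columns\<close>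

lemma insertion_tableau_Col:
  assumes "u \<in> Col S p"
  shows "insertion_tableau p u = transpose [rev u]"
  using insertion_tableau_columns[of p "[rev u]"] assms
  by (auto simp: Col_def super_columns_def super_column_iff)

lemma transpose_single: "transpose [c] = map (\<lambda>x. [x]) c"
  by (induction c) auto

lemma transpose_map_single: "transpose (map (\<lambda>x. [x]) c) = (if c = [] then [] else [c])"
proof (cases c)
  case (Cons a c')
  have "concat (map (case_list [] (\<lambda>h t. [h])) (map (\<lambda>x. [x]) c')) = c'"
    "concat (map (case_list [] (\<lambda>h t. [t])) (map (\<lambda>x. [x]) c')) = map (\<lambda>_. []) c'"
    by (induction c') auto
  then show ?thesis using Cons transpose_empty[of "map (\<lambda>_. []) c'"] by (simp add: comp_def)
qed simp

lemma juxtaposition_tableau_Col: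
  assumes "u \<in> Col S p" "v \<in> Col S p"
  shows "juxtaposition_tableau S p (insertion_tableau p u) (insertion_tableau p v) \<longleftrightarrow>
    (\<exists>R. super_tableau S p R \<and> transpose R = [rev u, rev v])"
  using assms
  by (auto simp: juxtaposition_tableau_def insertion_tableau_Col[OF assms(1)]
      insertion_tableau_Col[OF assms(2)] transpose_single transpose_map_single Col_def)

text \<open>Both sides of every plactic relation contain two letters, the earlier one in relation
  \<open>rowle\<close> to the later one, which cannot happen in a super column. Hence a super column
  is alone in its class. The disjunction in the hypothesis survives symmetry and
  transitivity.\<close>

lemma plactic_super_column:
  assumes "plactic S p u v" "super_column p u \<or> super_column p v"
  shows "u = v"
  using assms
proof (induction rule: gen_cong.induct)
  case (base u v)
  then have "knuth p u v" by (simp add: super_plactic_relations_knuth)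
  then show ?case using base
    by (cases rule: knuth.cases) (auto simp: super_column_iff dest: bumps_trans)
next
  case (append u v u' v')
  then show ?case by (auto simp: super_column_iff sorted_wrt_append)
qed auto

text \<open>The letter inserted last is always present in the row, and the next letter of the column
  bumps it or an entry further left. So only the first letter can lengthen the row.\<close>

lemma length_row_insert_column:
  assumes "super_column p v"
  shows "length (fst (row_insert_word p r v)) \<le> Suc (length r) \<and>
    (v \<noteq> [] \<longrightarrow> last v \<in> set (fst (row_insert_word p r v)))"
  using assms
proof (induction v rule: rev_induct)
  case (snoc x v)
  let ?r = "fst (row_insert_word p r v)"
  have r: "fst (row_insert_word p r (v @ [x])) = fst (row_insert p ?r x)"
    by (simp add: row_insert_word_append Let_def split_beta)
  have "x \<in> set (fst (row_insert p ?r x))"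
    by (cases ?r p x rule: row_insert_cases) (auto simp: row_insert_append row_insert_bump)
  moreover have "length (fst (row_insert p ?r x)) \<le> Suc (length r)"
  proof (cases "v = []")
    case True
    then show ?thesis
      by (cases r p x rule: row_insert_cases) (auto simp: row_insert_append row_insert_bump)
  next
    case False
    then have "bumps p x (last v)" using snoc.prems by (auto simp: super_column_iff)
    moreover have "last v \<in> set ?r" "length ?r \<le> Suc (length r)"
      using snoc False by (auto simp: super_column_iff)
    ultimately show ?thesis
      by (cases ?r p x rule: row_insert_cases) (auto simp: row_insert_bump)
  qed
  ultimately show ?case by (simp add: r)
qed simp

lemma length_column_readings:
  assumes T: "super_tableau S p T"
  shows "length (column_readings T) = (if T = [] then 0 else length (hd T))"
  using length_transpose_sorted[OF super_tableau_sorted[OF T]]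
  by (auto simp: column_readings_def hd_conv_nth)

text \<open>The tableau of \<open>u\<close> has a top row of length one, which grows by at most one
  while the column \<open>v\<close> is inserted.\<close>

lemma length_column_readings_append:
  assumes "u \<in> Col S p" "v \<in> Col S p"
  shows "length (column_readings (insertion_tableau p (u @ v))) \<in> {1, 2}"
proof -
  let ?T = "insertion_tableau p (u @ v)"
  have uv: "u @ v \<in> lists S" "u \<noteq> []" "super_column p v"
    using assms by (auto simp: Col_def super_columns_def)
  obtain x r where u: "insertion_tableau p u = [x] # r"
    using insertion_tableau_Col[OF assms(1)] uv by (cases "rev u") (auto simp: transpose_single)
  then have T: "?T = fst (row_insert_word p [x] v) #
      foldl (right_insert p) r (snd (row_insert_word p [x] v))"
    using foldl_right_insert_Cons[of p "[x]" r v] by (simp add: insertion_tableau_def)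
  have sT: "super_tableau S p ?T" by (rule super_tableau_insertion_tableau[OF uv(1)])
  then have "hd ?T \<noteq> []" using T by (simp add: super_tableau_Cons)
  moreover have "length (column_readings ?T) = length (hd ?T)"
    using T length_column_readings[OF sT] by simp
  ultimately show ?thesis using length_row_insert_column[OF uv(3), of "[x]"] T
    by (cases "hd ?T") (auto simp: le_Suc_eq)
qed

section \<open>The column rewriting system\<close>

text \<open>Both families of rules have the column reading of the product as target: a product has
  one or two columns, and a single column, being congruent to \<open>u @ v\<close>, is equal to
  it.\<close>

lemma Col2_iff:
  "(l, r) \<in> Col2 S p \<longleftrightarrow> (\<exists>u v. l = [u, v] \<and> u \<in> Col S p \<and> v \<in> Col S p \<and>
     \<not> juxtaposition_tableau S p (insertion_tableau p u) (insertion_tableau p v) \<and>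
     r = column_readings (insertion_tableau p (u @ v)))" (is "?L \<longleftrightarrow> ?R")
proof -
  have one: "column_readings (insertion_tableau p (u @ v)) = [u @ v]"
    if uv: "u \<in> Col S p" "v \<in> Col S p"
      and len: "length (column_readings (insertion_tableau p (u @ v))) = 1" for u v
  proof -
    have S: "u @ v \<in> lists S" using uv by (auto simp: Col_def super_columns_def)
    obtain w where w: "column_readings (insertion_tableau p (u @ v)) = [w]"
      using len by (auto simp: length_Suc_conv)
    then have "super_column p w"
      using column_readings_Col[OF super_tableau_insertion_tableau[OF S, of p]]
      by (auto simp: Col_def super_columns_def)
    then show ?thesis using plactic_super_column plactic_column_readings[OF S, of p] w by fastforce
  qed
  show ?thesis
  proof
    assume ?L
    then show ?R unfolding Col2_def using one by fastforce
  next
    assume ?R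
    then obtain u v where uv: "l = [u, v]" "u \<in> Col S p" "v \<in> Col S p"
      "\<not> juxtaposition_tableau S p (insertion_tableau p u) (insertion_tableau p v)"
      "r = column_readings (insertion_tableau p (u @ v))" by blast
    then consider "length r = 1" | w w' where "r = [w, w']"
      using length_column_readings_append[of u S p v] by (auto simp: length_Suc_conv numeral_2_eq_2)
    then show ?L
      by cases (use uv one[of u v] in \<open>auto simp: Col2_def\<close>)
  qed
qed

lemma Col2_plactic:
  assumes "(l, r) \<in> Col2 S p"
  shows "l \<in> lists (Col S p)" "r \<in> lists (Col S p)" "plactic S p (concat l) (concat r)"
proof -
  obtain u v where uv: "l = [u, v]" "u \<in> Col S p" "v \<in> Col S p"
    "r = column_readings (insertion_tableau p (u @ v))" using assms by (auto simp: Col2_iff)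
  then have S: "u @ v \<in> lists S" by (auto simp: Col_def super_columns_def)
  show "l \<in> lists (Col S p)" using uv by auto
  show "r \<in> lists (Col S p)"
    using column_readings_Col[OF super_tableau_insertion_tableau[OF S]] uv by simp
  show "plactic S p (concat l) (concat r)" using plactic_column_readings[OF S] uv by simp
qed

lemma rewrite_step_Col2:
  assumes "rewrite_step (Col S p) (Col2 S p) U V"
  shows "U \<in> lists (Col S p)" "V \<in> lists (Col S p)" "gen_cong (Col S p) (Col2 S p) U V"
    "plactic S p (concat U) (concat V)"
proof -
  from assms have "U \<in> lists (Col S p) \<and> V \<in> lists (Col S p) \<and>
    gen_cong (Col S p) (Col2 S p) U V \<and> plactic S p (concat U) (concat V)"
  proof cases
  case (1 l r a b)
  have "gen_cong (Col S p) (Col2 S p) (a @ l @ b) (a @ r @ b)"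
    using 1 by (intro gen_cong.append gen_cong.refl gen_cong.base)
  moreover have "plactic S p (concat a @ concat l @ concat b) (concat a @ concat r @ concat b)"
    using 1 Col2_plactic[of l r S p] Col_lists[of a S p] Col_lists[of b S p]
    by (intro gen_cong.append gen_cong.refl)
  ultimately show ?thesis using 1 by auto
  qed
  then show "U \<in> lists (Col S p)" "V \<in> lists (Col S p)" "gen_cong (Col S p) (Col2 S p) U V"
    "plactic S p (concat U) (concat V)" by blast+
qed

lemma gen_cong_Col2_plactic:
  assumes "gen_cong (Col S p) (Col2 S p) U V"
  shows "plactic S p (concat U) (concat V)"
  using assms
proof (induction rule: gen_cong.induct)
  case (base U V)
  then show ?case by (auto dest: Col2_plactic)
next
  case (refl U)
  then show ?case by (intro gen_cong.refl Col_lists)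
next
  case (append U V U' V')
  then show ?case by (auto intro: gen_cong.append)
qed (blast intro: gen_cong.sym gen_cong.trans)+

section \<open>Termination\<close>

lemma right_insert_first_column:
  assumes "\<forall>r\<in>set T. r \<noteq> []"
  shows "length T \<le> length (right_insert p T x) \<and>
    (\<forall>i<length T. hd (right_insert p T x ! i) \<le> hd (T ! i))"
  using assms
proof (induction T arbitrary: x)
  case Nil
  then show ?case by simp
next
  case (Cons r rs)
  show ?case
  proof (cases r p x rule: row_insert_cases)
    case append
    then show ?thesis using Cons.prems
      by (auto simp: right_insert_Cons row_insert_append nth_Cons'
          simp del: right_insert.simps(2))
  next
    case (bump A y B)
    have "hd (A @ x # B) \<le> hd r" using bump by (cases A) (auto simp: bumps_iff)
    moreover have "length rs \<le> length (right_insert p rs y)"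
      "\<forall>i<length rs. hd (right_insert p rs y ! i) \<le> hd (rs ! i)"
      using Cons by auto
    moreover have "row_insert p r x = (A @ x # B, [y])" using bump by (simp add: row_insert_bump)
    ultimately show ?thesis
      by (auto simp: right_insert_Cons nth_Cons' simp del: right_insert.simps(2))
  qed
qed

lemma insertion_tableau_first_column:
  assumes "u @ v \<in> lists S"
  shows "length (insertion_tableau p u) \<le> length (insertion_tableau p (u @ v)) \<and>
    (\<forall>i<length (insertion_tableau p u).
      hd (insertion_tableau p (u @ v) ! i) \<le> hd (insertion_tableau p u ! i))"
  using assms
proof (induction v rule: rev_induct)
  case (snoc x v)
  let ?T = "insertion_tableau p (u @ v)"
  have "super_tableau S p ?T"
    using snoc.prems by (intro super_tableau_insertion_tableau) simp
  then have "\<forall>r\<in>set ?T. r \<noteq> []" by (simp add: super_tableau_iff)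
  from right_insert_first_column[OF this, of p x]
  have 1: "length ?T \<le> length (right_insert p ?T x)"
    "\<And>i. i < length ?T \<Longrightarrow> hd (right_insert p ?T x ! i) \<le> hd (?T ! i)" by auto
  have 2: "length (insertion_tableau p u) \<le> length ?T"
    "\<And>i. i < length (insertion_tableau p u) \<Longrightarrow> hd (?T ! i) \<le> hd (insertion_tableau p u ! i)"
    using snoc by auto
  have "hd (right_insert p ?T x ! i) \<le> hd (insertion_tableau p u ! i)"
    if "i < length (insertion_tableau p u)" for i
    using order.trans[OF 1(2) 2(2)[OF that]] 2(1) that by simp
  moreover have "insertion_tableau p (u @ v @ [x]) = right_insert p ?T x"
    using insertion_tableau_snoc[of p "u @ v" x] by simp
  ultimately show ?case using 1(1) 2(1) by simp
qed simp

lemma Col2_first_column: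
  assumes "(l, r) \<in> Col2 S p"
  obtains u v w where "l = [u, v]" "r = [w]"
  | u v w w' where "l = [u, v]" "r = [w, w']" "w \<noteq> u" "length u \<le> length w"
    "\<And>i. i < length u \<Longrightarrow> rev w ! i \<le> rev u ! i"
proof -
  obtain u v where uv: "l = [u, v]" "u \<in> Col S p" "v \<in> Col S p"
    "\<not> juxtaposition_tableau S p (insertion_tableau p u) (insertion_tableau p v)"
    "r = column_readings (insertion_tableau p (u @ v))" using assms by (auto simp: Col2_iff)
  define T where "T = insertion_tableau p (u @ v)"
  have S: "u @ v \<in> lists S" using uv by (auto simp: Col_def super_columns_def)
  have T: "super_tableau S p T" unfolding T_def by (rule super_tableau_insertion_tableau[OF S])
  consider w where "r = [w]" | w w' where "r = [w, w']"
    using length_column_readings_append[OF uv(2,3)] uv(5)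
    by (auto simp: length_Suc_conv numeral_2_eq_2)
  then show thesis
  proof cases
    case 1
    then show ?thesis using uv that(1) by blast
  next
    case (2 w w')
    have tr: "transpose T = [rev w, rev w']"
      using 2 uv(5) unfolding T_def column_readings_def by (auto simp: rev_swap)
    have Tu: "insertion_tableau p u = map (\<lambda>x. [x]) (rev u)"
      by (simp add: insertion_tableau_Col[OF uv(2)] transpose_single)
    \<comment> \<open>If \<open>w = u\<close>, then \<open>w'\<close> has the letters of
      \<open>v\<close>. A column is determined by its letters, so \<open>w' = v\<close>, and
      \<open>T\<close> itself is the juxtaposition that the rule excludes.\<close>
    have "w \<noteq> u"
    proof
      assume "w = u"
      have ww': "w \<in> Col S p" "w' \<in> Col S p" using Col2_plactic(2)[OF assms] 2 by auto
      have "mset (u @ v) = mset (w @ w')"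
        using plactic_mset[OF Col2_plactic(3)[OF assms]] 2 uv by simp
      then have "mset (rev v) = mset (rev w')" using \<open>w = u\<close> by simp
      moreover have "sorted (rev c)" if "c \<in> Col S p" for c
        using that by (auto simp: Col_def super_columns_def super_column_iff bumps_iff
            elim: sorted_wrt_mono_rel[rotated])
      ultimately have "rev v = rev w'" using ww' uv(3) by (metis properties_for_sort)
      then show False using uv T tr \<open>w = u\<close> by (auto simp: juxtaposition_tableau_Col)
    qed
    moreover have fc: "length u \<le> length T" "\<And>i. i < length u \<Longrightarrow> hd (T ! i) \<le> rev u ! i"
      using insertion_tableau_first_column[OF S, of p] Tu unfolding T_def by auto
    moreover have w: "length w = length T"
    proof -
      have "filter (\<lambda>r. 0 < length r) T = T" using T by (auto simp: super_tableau_iff filter_id_conv)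
      then show ?thesis using nth_transpose[of 0 T] tr by (auto dest: arg_cong[of _ _ length])
    qed
    moreover have "rev w ! i = hd (T ! i)" if "i < length w" for i
      using nth_transpose_super_tableau[OF T, of 0 i] tr that by (auto simp: hd_conv_nth)
    ultimately show ?thesis using that(2)[OF uv(1) 2] by auto
  qed
qed

text \<open>For finite \<open>F\<close>, an entry from \<open>F\<close> contributes at least one,
  namely itself, and more the smaller it is. So lengthening a column and lowering its entries both
  increase the weight.\<close>

definition column_weight :: "'a::linorder set \<Rightarrow> 'a list \<Rightarrow> nat" where
  "column_weight F c = (\<Sum>x\<leftarrow>c. card {y \<in> F. x \<le> y})"

text \<open>No term shrinks. Where an entry drops strictly, the new entry is counted in addition; if
  no entry drops, \<open>d\<close> is longer and its extra entries contribute.\<close>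

lemma column_weight_less:
  assumes "finite F" "set c \<subseteq> F" "set d \<subseteq> F" "length c \<le> length d"
    "\<And>i. i < length c \<Longrightarrow> d ! i \<le> c ! i" "c \<noteq> d"
  shows "column_weight F c < column_weight F d"
  using assms(2-)
proof (induction c arbitrary: d)
  case Nil
  then obtain y ys where "d = y # ys" "y \<in> F" by (cases d) auto
  then have "card {z \<in> F. y \<le> z} > 0" using \<open>finite F\<close> by (auto simp: card_gt_0_iff)
  then show ?case using \<open>d = y # ys\<close> by (simp add: column_weight_def)
next
  case (Cons x xs)
  obtain y ys where d: "d = y # ys" using Cons.prems by (cases d) auto
  have yx: "y \<le> x" using Cons.prems(4)[of 0] d by simp
  have tl: "column_weight F xs < column_weight F ys" if "xs \<noteq> ys"
  proof (rule Cons.IH)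
    show "ys ! i \<le> xs ! i" if "i < length xs" for i using Cons.prems(4)[of "Suc i"] that d by simp
  qed (use Cons.prems d that in auto)
  have hd: "card {z \<in> F. x \<le> z} < card {z \<in> F. y \<le> z}" if "x \<noteq> y"
  proof (rule psubset_card_mono)
    have "y \<in> {z \<in> F. y \<le> z}" "y \<notin> {z \<in> F. x \<le> z}" using that yx Cons.prems d by auto
    moreover have "{z \<in> F. x \<le> z} \<subseteq> {z \<in> F. y \<le> z}" using yx by auto
    ultimately show "{z \<in> F. x \<le> z} \<subset> {z \<in> F. y \<le> z}" by blast
  qed (use \<open>finite F\<close> in simp)
  show ?case using tl hd Cons.prems(5) d
    by (cases "x = y"; cases "xs = ys") (auto simp: column_weight_def)
qed

lemma column_weight_le:
  assumes "finite F"
  shows "column_weight F c \<le> length c * card F"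
proof (induction c)
  case (Cons x c)
  have "card {y \<in> F. x \<le> y} \<le> card F" using assms by (intro card_mono) auto
  then show ?case using Cons by (simp add: column_weight_def)
qed (simp add: column_weight_def)

text \<open>Length settles the rules with one column as target, the first changed column the others.
  Subtracting from \<open>length w * card (set w)\<close> reverses the growth of the weight; as this
  bounds the weight of every column in a word with the letters of \<open>w\<close>, the subtraction
  never truncates there.\<close>

definition weight_order :: "'a::linorder list \<Rightarrow> ('a list list \<times> 'a list list) set" where
  "weight_order w =
     lenlex (measure (\<lambda>c. length w * card (set w) - column_weight (set w) c))"

lemma rewrite_step_decreasing:
  assumes step: "rewrite_step (Col S p) (Col2 S p) U V" and mset: "mset (concat U) = mset w"
  shows "(V, U) \<in> weight_order w"
proof -
  have "mset (concat V) = mset w"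
    using plactic_mset[OF rewrite_step_Col2(4)[OF step]] mset by simp
  then have V: "set (concat V) = set w" "length (concat V) = length w"
    by (metis set_mset_mset, metis size_mset)
  have U: "set (concat U) = set w" by (metis mset set_mset_mset)
  from step show ?thesis
  proof cases
    case (1 l r a b)
    show ?thesis
    proof (rule Col2_first_column[OF \<open>(l, r) \<in> Col2 S p\<close>])
      fix u v x assume "l = [u, v]" "r = [x]"
      then show ?thesis using 1 by (simp add: weight_order_def lenlex_conv)
    next
      fix u v x y
      assume lr: "l = [u, v]" "r = [x, y]" "x \<noteq> u" "length u \<le> length x"
        "\<And>i. i < length u \<Longrightarrow> rev x ! i \<le> rev u ! i"
      have "column_weight (set w) (rev u) < column_weight (set w) (rev x)"
        using lr 1 U V by (intro column_weight_less) auto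
      moreover have "column_weight (set w) (rev c) = column_weight (set w) c" for c :: "'a list"
        by (simp add: column_weight_def sum_list_rev rev_map[symmetric])
      moreover have "column_weight (set w) x \<le> length w * card (set w)"
      proof -
        have "length x \<le> length w" using V 1 lr by auto
        then show ?thesis using column_weight_le[of "set w" x]
          by (meson List.finite_set mult_le_mono1 order.trans)
      qed
      ultimately have "length w * card (set w) - column_weight (set w) x
          < length w * card (set w) - column_weight (set w) u"
        by simp
      then show ?thesis using 1 lr
        by (auto simp: weight_order_def lenlex_conv lex_conv)
    qed
  qed
qed

lemma terminating_Col2: "terminating_rs (Col S p) (Col2 S p)"
proof -
  let ?r = "{(V, U). rewrite_step (Col S p) (Col2 S p) U V}"
  have "wf ?r"
    unfolding wf_iff_no_infinite_down_chain
  proof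
    assume "\<exists>f. \<forall>i. (f (Suc i), f i) \<in> ?r"
    then obtain f where f: "\<And>i. rewrite_step (Col S p) (Col2 S p) (f i) (f (Suc i))" by auto
    \<comment> \<open>The order depends on a word, so it is fixed along an infinite chain: all words
      of the chain share the letters of the first one.\<close>
    define w where "w = concat (f 0)"
    have "mset (concat (f i)) = mset w" for i
      by (induction i) (use plactic_mset[OF rewrite_step_Col2(4)[OF f]] in \<open>auto simp: w_def\<close>)
    then have "(f (Suc i), f i) \<in> weight_order w" for i
      using rewrite_step_decreasing[OF f] by blast
    moreover have "wf (weight_order w)" by (simp add: weight_order_def wf_lenlex)
    ultimately show False unfolding wf_iff_no_infinite_down_chain by blast
  qed
  then show ?thesis by (simp add: terminating_rs_def wfp_def conversep_iff)
qed

section \<open>Normal forms\<close>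

text \<open>The rules control adjacent columns only; transitivity of juxtaposability extends this to
  all pairs.\<close>

lemma irreducible_juxtaposable:
  assumes U: "U \<in> lists (Col S p)" and irr: "\<nexists>V. rewrite_step (Col S p) (Col2 S p) U V"
  shows "sorted_wrt (juxtaposable p) (map rev U)"
proof -
  have "juxtaposable p (rev (U ! i)) (rev (U ! Suc i))" if i: "Suc i < length U" for i
  proof -
    let ?u = "U ! i" and ?v = "U ! Suc i"
    let ?r = "column_readings (insertion_tableau p (?u @ ?v))"
    have split: "U = take i U @ [?u, ?v] @ drop (Suc (Suc i)) U"
      using i by (simp add: Cons_nth_drop_Suc id_take_nth_drop[of i U, symmetric])
    have C: "?u \<in> Col S p" "?v \<in> Col S p" using U i by (auto simp: in_lists_conv_set)
    have "([?u, ?v], ?r) \<notin> Col2 S p"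
    proof
      assume r: "([?u, ?v], ?r) \<in> Col2 S p"
      then have "rewrite_step (Col S p) (Col2 S p) (take i U @ [?u, ?v] @ drop (Suc (Suc i)) U)
          (take i U @ ?r @ drop (Suc (Suc i)) U)"
        using U Col2_plactic(1,2)[OF r]
        by (intro rewrite_step.intros) (auto simp: in_lists_conv_set dest: in_set_takeD in_set_dropD)
      then show False using irr split by metis
    qed
    then obtain R where R: "super_tableau S p R" "transpose R = [rev ?u, rev ?v]"
      using C by (auto simp: Col2_iff juxtaposition_tableau_Col)
    then show ?thesis using super_tableau_columns(1)[OF R(1)] by simp
  qed
  then show ?thesis
    by (subst sorted_wrt_iff_nth_Suc_transp)
      (auto simp: transp_on_def intro: juxtaposable_trans)
qed

text \<open>An irreducible word is rebuilt from the insertion tableau of its concatenation by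
  transposing: its columns are nonempty and their lengths decrease weakly, so nothing is
  lost.\<close>

lemma irreducible_unique:
  assumes "U \<in> lists (Col S p)" "\<nexists>W. rewrite_step (Col S p) (Col2 S p) U W"
    "V \<in> lists (Col S p)" "\<nexists>W. rewrite_step (Col S p) (Col2 S p) V W"
    "plactic S p (concat U) (concat V)"
  shows "U = V"
proof -
  have *: "map rev U = transpose (insertion_tableau p (concat U))"
    if U: "U \<in> lists (Col S p)" "\<nexists>W. rewrite_step (Col S p) (Col2 S p) U W" for U
  proof -
    have s: "sorted_wrt (juxtaposable p) (map rev U)" by (rule irreducible_juxtaposable[OF U])
    have "insertion_tableau p (concat U) = transpose (map rev U)"
      using insertion_tableau_columns[OF s] U(1)
      by (auto simp: Col_def super_columns_def super_column_iff comp_def in_lists_conv_set)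
    moreover have "sorted (rev (map length (map rev U)))"
      using s by (auto simp: sorted_wrt_rev sorted_wrt_map juxtaposable_def
          elim: sorted_wrt_mono_rel[rotated])
    moreover have "takeWhile (\<lambda>c. c \<noteq> []) (map rev U) = map rev U"
      using U(1) by (auto simp: takeWhile_eq_all_conv Col_def in_lists_conv_set)
    ultimately show ?thesis by (simp only: transpose_transpose)
  qed
  have "map rev U = map rev V" using *[OF assms(1,2)] *[OF assms(3,4)]
    plactic_insertion_tableau[OF assms(5)] by simp
  then show ?thesis by (simp add: inj_map_eq_map[OF inj_on_rev])
qed

lemma rewrite_steps_Col2:
  assumes "(rewrite_step (Col S p) (Col2 S p))\<^sup>*\<^sup>* U V" "U \<in> lists (Col S p)"
  shows "V \<in> lists (Col S p) \<and> gen_cong (Col S p) (Col2 S p) U V"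
  using assms
proof induction
  case base
  then show ?case by (auto intro: gen_cong.refl)
next
  case (step V W)
  then show ?case using rewrite_step_Col2[of S p V W] by (blast intro: gen_cong.trans)
qed

lemma irreducible_exists:
  "\<exists>V. (rewrite_step (Col S p) (Col2 S p))\<^sup>*\<^sup>* U V \<and>
    (\<nexists>W. rewrite_step (Col S p) (Col2 S p) V W)"
proof -
  have "wfp (rewrite_step (Col S p) (Col2 S p))\<inverse>\<inverse>"
    using terminating_Col2 by (simp add: terminating_rs_def)
  then show ?thesis
  proof (induction U rule: wfp_induct_rule)
    case (less U)
    then show ?case
      by (metis conversepI converse_rtranclp_into_rtranclp rtranclp.rtrancl_refl)
  qed
qed

text \<open>Both reducts are continued to irreducible words. These have the plactic class of the
  common source and therefore coincide.\<close>

lemma confluent_Col2: "confluent_rs (Col S p) (Col2 S p)"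
  unfolding confluent_rs_def
proof (rule confluentpI)
  let ?s = "rewrite_step (Col S p) (Col2 S p)"
  fix U V W assume UV: "?s\<^sup>*\<^sup>* U V" and UW: "?s\<^sup>*\<^sup>* U W"
  show "\<exists>X. ?s\<^sup>*\<^sup>* V X \<and> ?s\<^sup>*\<^sup>* W X"
  proof (cases "U \<in> lists (Col S p)")
    case True
    obtain V' where V': "?s\<^sup>*\<^sup>* V V'" "\<nexists>X. ?s V' X" using irreducible_exists by blast
    obtain W' where W': "?s\<^sup>*\<^sup>* W W'" "\<nexists>X. ?s W' X" using irreducible_exists by blast
    have "?s\<^sup>*\<^sup>* U V'" "?s\<^sup>*\<^sup>* U W'" using UV UW V' W' by auto
    then have L: "V' \<in> lists (Col S p)" "W' \<in> lists (Col S p)"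
        and g: "gen_cong (Col S p) (Col2 S p) U V'" "gen_cong (Col S p) (Col2 S p) U W'"
      using rewrite_steps_Col2 True by metis+
    have "plactic S p (concat V') (concat W')"
      using g by (metis gen_cong.sym gen_cong.trans gen_cong_Col2_plactic)
    then have "V' = W'" using irreducible_unique V' W' L by metis
    then show ?thesis using V' W' by blast
  next
    case False
    \<comment> \<open>The step relation lives on all lists of the type, but a list with an entry
      outside \<open>Col S p\<close> admits no step.\<close>
    then have "\<nexists>X. ?s U X" using rewrite_step_Col2(1) by metis
    then have "V = U" "W = U" using UV UW by (metis converse_rtranclpE)+
    then show ?thesis by blast
  qed
qed

section \<open>The presented monoid\<close>

text \<open>For completeness of the rules, both words are reduced to irreducible ones, which agree
  as soon as the concatenations are congruent.\<close>

lemma gen_cong_Col2_iff: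
  assumes "U \<in> lists (Col S p)" "V \<in> lists (Col S p)"
  shows "gen_cong (Col S p) (Col2 S p) U V \<longleftrightarrow> plactic S p (concat U) (concat V)"
proof
  let ?s = "rewrite_step (Col S p) (Col2 S p)"
  assume UV: "plactic S p (concat U) (concat V)"
  obtain U' where U': "?s\<^sup>*\<^sup>* U U'" "\<nexists>X. ?s U' X" using irreducible_exists by blast
  obtain V' where V': "?s\<^sup>*\<^sup>* V V'" "\<nexists>X. ?s V' X" using irreducible_exists by blast
  have g: "U' \<in> lists (Col S p)" "gen_cong (Col S p) (Col2 S p) U U'"
      "V' \<in> lists (Col S p)" "gen_cong (Col S p) (Col2 S p) V V'"
    using rewrite_steps_Col2 U'(1) V'(1) assms by metis+
  then have "plactic S p (concat U') (concat V')"
    using UV by (metis gen_cong.sym gen_cong.trans gen_cong_Col2_plactic)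
  then have "U' = V'" using irreducible_unique U' V' g by metis
  then show "gen_cong (Col S p) (Col2 S p) U V" using g by (metis gen_cong.sym gen_cong.trans)
qed (rule gen_cong_Col2_plactic)

text \<open>A homomorphism between free monoids induces an isomorphism of the quotients if it
  preserves the congruence (well-definedness), reflects it (injectivity) and meets every class
  (surjectivity).\<close>

lemma presented_monoid_iso:
  assumes hom: "h [] = []" "\<And>u v. u \<in> lists A \<Longrightarrow> v \<in> lists A \<Longrightarrow> h (u @ v) = h u @ h v"
    and closed: "\<And>u. u \<in> lists A \<Longrightarrow> h u \<in> lists B"
    and cong: "\<And>u v. u \<in> lists A \<Longrightarrow> v \<in> lists A \<Longrightarrow> gen_cong A R u v \<longleftrightarrow> gen_cong B Q (h u) (h v)"
    and surj: "\<And>w. w \<in> lists B \<Longrightarrow> \<exists>u\<in>lists A. gen_cong B Q (h u) w"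
  shows "presented_monoid A R \<cong> presented_monoid B Q"
proof -
  \<comment> \<open>On a congruence class all members of this union are equal, so no representative
    has to be chosen.\<close>
  define f where "f X = (\<Union>u\<in>X. cong_class B Q (h u))" for X
  have f: "f (cong_class A R u) = cong_class B Q (h u)" if u: "u \<in> lists A" for u
  proof -
    have "cong_class B Q (h v) = cong_class B Q (h u)" if "v \<in> cong_class A R u" for v
    proof -
      have "gen_cong A R u v" using that by (simp add: cong_class_def)
      then show ?thesis
        using cong cong_class_eq_iff[OF closed] gen_cong_in_lists u by metis
    qed
    moreover have "u \<in> cong_class A R u" using u by (simp add: cong_class_def gen_cong.refl)
    ultimately show ?thesis unfolding f_def by blast
  qed
  have "f \<in> iso (presented_monoid A R) (presented_monoid B Q)"
  proof (rule isoI)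
    show "f \<in> hom (presented_monoid A R) (presented_monoid B Q)"
    proof (rule homI)
      fix X assume "X \<in> carrier (presented_monoid A R)"
      then obtain u where "u \<in> lists A" "X = cong_class A R u" by (auto simp: presented_monoid_def)
      then show "f X \<in> carrier (presented_monoid B Q)"
        using closed by (simp add: presented_monoid_def f)
    next
      fix X Y
      assume "X \<in> carrier (presented_monoid A R)" "Y \<in> carrier (presented_monoid A R)"
      then obtain u v where "u \<in> lists A" "X = cong_class A R u" "v \<in> lists A" "Y = cong_class A R v"
        by (auto simp: presented_monoid_def)
      then show "f (X \<otimes>\<^bsub>presented_monoid A R\<^esub> Y) = f X \<otimes>\<^bsub>presented_monoid B Q\<^esub> f Y"
        using closed by (simp add: presented_monoid_mult_class f hom)
    qed
    show "bij_betw f (carrier (presented_monoid A R)) (carrier (presented_monoid B Q))"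
    proof (rule bij_betw_imageI)
      show "inj_on f (carrier (presented_monoid A R))"
      proof (rule inj_onI)
        fix X Y
        assume "X \<in> carrier (presented_monoid A R)" "Y \<in> carrier (presented_monoid A R)" "f X = f Y"
        then obtain u v where uv: "u \<in> lists A" "X = cong_class A R u" "v \<in> lists A"
          "Y = cong_class A R v" by (auto simp: presented_monoid_def)
        then have "cong_class B Q (h u) = cong_class B Q (h v)" using \<open>f X = f Y\<close> by (simp add: f)
        with uv show "X = Y" using cong cong_class_eq_iff closed by metis
      qed
      have "cong_class B Q w \<in> f ` cong_class A R ` lists A" if w: "w \<in> lists B" for w
      proof -
        obtain u where "u \<in> lists A" "gen_cong B Q (h u) w" using surj[OF w] by blast
        then have "cong_class B Q w = f (cong_class A R u)"
          using f cong_class_eq_iff[OF closed] by metis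
        then show ?thesis using \<open>u \<in> lists A\<close> by blast
      qed
      moreover have "f (cong_class A R u) \<in> cong_class B Q ` lists B" if "u \<in> lists A" for u
        using f[OF that] closed[OF that] by blast
      ultimately show "f ` carrier (presented_monoid A R) = carrier (presented_monoid B Q)"
        unfolding presented_monoid_def partial_object.simps by blast
    qed
  qed
  then show ?thesis by (auto simp: is_iso_def)
qed

theorem theorem2p5:
  fixes S :: "'a::linorder set" and p :: "'a \<Rightarrow> bit"
  assumes "countable S"
  shows "convergent_rs (Col S p) (Col2 S p) \<and>
         presented_monoid (Col S p) (Col2 S p) \<cong> super_plactic_monoid S p"
proof
  show "convergent_rs (Col S p) (Col2 S p)"
    by (simp add: convergent_rs_def terminating_Col2 confluent_Col2)
  show "presented_monoid (Col S p) (Col2 S p) \<cong> super_plactic_monoid S p"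
    unfolding super_plactic_monoid_def
  proof (rule presented_monoid_iso[where h = concat])
    fix w assume w: "w \<in> lists S"
    \<comment> \<open>The symbol of a column is sent to its word, so a word \<open>w\<close> is
      reached from its letters taken as columns of length one.\<close>
    have "map (\<lambda>x. [x]) w \<in> lists (Col S p)"
      using w by (auto simp: Col_def super_columns_def super_column_def)
    moreover have "concat (map (\<lambda>x. [x]) w) = w" by simp
    ultimately show "\<exists>U\<in>lists (Col S p). plactic S p (concat U) w"
      using gen_cong.refl[OF w] by metis
  qed (simp_all add: Col_lists gen_cong_Col2_iff)
qed

end
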